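(* For $n\ge1$ define the $\{0,1\}$-valued stochastic process $X^{(n)}=(X^{(n)}_t)_{t\in[1,\infty)}$ by $$X^{(n)}_t:=\mathbf{1}\{L_{tn^2}=n\},$$ the indicator that the $n$-detachment process is in a state of detachment at time $tn^2$. Then, as $n\to\infty$, the processes $X^{(n)}$ converge in the sense of finite-dimensional distributions to a process on $[1,\infty)$ with càdlàg paths.
   Context: The $n$-detachment process ($n\ge1$): there are $n$ labeled passengers. At time $1$ all passengers sit in bus number $1$. At each integer time $k\ge 2$, a new bus with number $k$ becomes available and each passenger (currently sitting in one of the buses $1,\dots,k-1$), independently of the others and of the past, relocates to bus $k$ with probability $1/k$ and otherwise stays where they are. The process is extended to real times $t\ge1$ by letting its state at time $t$ be its state at time $\lfloor t\rfloor$ (so $X^{(n)}$ has càdlàg paths). A passenger is lonely at time $t$ if no other passenger is in the same bus at time $t$; $L_t$ denotes the number of lonely passengers at time $t$. The process is in a state of detachment at time $t$ if $L_t=n$. *)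

theory Defs
  imports "HOL-Probability.Probability"
begin

text \<open>
  \<open>R k i \<omega>\<close> states that passenger \<open>i\<close> relocates to the new bus \<open>k\<close> at time \<open>k\<close>. The value
  of \<open>bus\<close> at time 0 plays no role.
\<close>

fun bus :: "(nat \<Rightarrow> nat \<Rightarrow> 'a \<Rightarrow> bool) \<Rightarrow> nat \<Rightarrow> nat \<Rightarrow> 'a \<Rightarrow> nat" where
  "bus R i k \<omega> = (if k \<le> 1 then 1 else if R k i \<omega> then k else bus R i (k - 1) \<omega>)"

declare bus.simps [simp del]

text \<open>
  The passengers are \<open>1, \<dots>, n\<close>. Since the bus occupied before time \<open>k\<close> is a function of the
  relocation events at earlier times, mutual independence of all relocation events says that
  passengers move independently of each other and of the past.
\<close>

locale detachment_process = prob_space M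
  for M :: "'a measure" and n :: nat and R :: "nat \<Rightarrow> nat \<Rightarrow> 'a \<Rightarrow> bool" +
  assumes n_pos: "n \<ge> 1"
    and indep_relocations:
      "indep_events (\<lambda>(k, i). {\<omega> \<in> space M. R k i \<omega>}) ({2..} \<times> {1..n})"
    and prob_relocation:
      "\<And>k i. k \<ge> 2 \<Longrightarrow> i \<in> {1..n} \<Longrightarrow> prob {\<omega> \<in> space M. R k i \<omega>} = 1 / real k"

text \<open>The process exists, so the locale is not vacuous.\<close>

lemma detachment_process_exists:
  assumes "n \<ge> 1"
  shows "detachment_process
    (PiM UNIV (\<lambda>(k, i). measure_pmf (bernoulli_pmf (1 / real k)))) n (\<lambda>k i \<omega>. \<omega> (k, i))"
proof -
  define B :: "nat \<times> nat \<Rightarrow> bool measure"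
    where "B = (\<lambda>(k, i). measure_pmf (bernoulli_pmf (1 / real k)))"
  have B: "prob_space (B x)" "sets (B x) = UNIV" for x
    by (auto simp: B_def split: prod.split intro: measure_pmf.prob_space_axioms)
  interpret P: product_prob_space B UNIV
    by (rule product_prob_spaceI) (rule B)
  have spB: "space (B x) = UNIV" for x
    using B(2)[of x] sets.sets_into_space[of UNIV "B x"] by auto
  have space: "space (PiM UNIV B) = UNIV"
    by (simp add: space_PiM spB)
  have r: "restrict f J = (\<lambda>_\<in>J. True) \<longleftrightarrow> (\<forall>x\<in>J. f x)" for f and J :: "(nat \<times> nat) set"
    unfolding fun_eq_iff restrict_def by meson
  have eq: "(\<Inter>x\<in>J. {\<omega> \<in> space (PiM UNIV B). \<omega> x}) =
      prod_emb UNIV B J (Pi\<^sub>E J (\<lambda>_. {True}))" if "J \<noteq> {}" for J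
    using that by (auto simp: prod_emb_def space space_PiM spB r)
  have prob: "P.prob (\<Inter>x\<in>J. {\<omega> \<in> space (PiM UNIV B). \<omega> x}) = (\<Prod>x\<in>J. measure (B x) {True})"
    if "J \<noteq> {}" "finite J" for J
    unfolding eq[OF that(1)] using that by (intro P.measure_PiM_emb) (auto simp: B)
  have prob1: "P.prob {\<omega> \<in> space (PiM UNIV B). \<omega> x} = measure (B x) {True}" for x
    using prob[of "{x}"] by simp
  have meas: "{\<omega> \<in> space (PiM UNIV B). \<omega> x} \<in> P.events" for x
    by (intro sets_Collect_single') (auto simp: B)
  have "P.indep_events (\<lambda>x. {\<omega> \<in> space (PiM UNIV B). \<omega> x}) ({2..} \<times> {1..n})"
    by (intro P.indep_eventsI meas) (simp add: prob prob1)
  moreover have "P.prob {\<omega> \<in> space (PiM UNIV B). \<omega> (k, i)} = 1 / real k" if "k \<ge> 2" for k i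
    using that by (simp only: prob1) (simp add: B_def measure_pmf_single)
  ultimately have "detachment_process (PiM UNIV B) n (\<lambda>k i \<omega>. \<omega> (k, i))"
    using assms by unfold_locales (simp_all add: case_prod_unfold)
  then show ?thesis
    by (simp add: B_def)
qed

definition bus_at :: "(nat \<Rightarrow> nat \<Rightarrow> 'a \<Rightarrow> bool) \<Rightarrow> nat \<Rightarrow> real \<Rightarrow> 'a \<Rightarrow> nat" where
  "bus_at R i t \<omega> = bus R i (nat \<lfloor>t\<rfloor>) \<omega>"

definition lonely :: "nat \<Rightarrow> (nat \<Rightarrow> nat \<Rightarrow> 'a \<Rightarrow> bool) \<Rightarrow> real \<Rightarrow> 'a \<Rightarrow> nat" where
  "lonely n R t \<omega> =
     card {i \<in> {1..n}. \<forall>j \<in> {1..n}. j \<noteq> i \<longrightarrow> bus_at R j t \<omega> \<noteq> bus_at R i t \<omega>}"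

definition detachment_indicator ::
  "nat \<Rightarrow> (nat \<Rightarrow> nat \<Rightarrow> 'a \<Rightarrow> bool) \<Rightarrow> real \<Rightarrow> 'a \<Rightarrow> real" where
  "detachment_indicator n R t \<omega> = (if lonely n R (t * real n ^ 2) \<omega> = n then 1 else 0)"

definition cadlag_on_ge1 :: "(real \<Rightarrow> real) \<Rightarrow> bool" where
  "cadlag_on_ge1 f \<longleftrightarrow>
     (\<forall>t\<ge>1. (f \<longlongrightarrow> f t) (at_right t)) \<and> (\<forall>t>1. \<exists>l. (f \<longlongrightarrow> l) (at_left t))"

text \<open>
  Weak convergence of finite-dimensional laws, by test functions. For a finite set \<open>J\<close> of times,
  \<open>\<real>\<close> to the power \<open>J\<close> is represented by the extensional functions on \<open>J\<close>, which is the
  carrier both of the product sigma-algebra and of the product topology below.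
\<close>

definition fin_dim_law :: "'a measure \<Rightarrow> (real \<Rightarrow> 'a \<Rightarrow> real) \<Rightarrow> real set \<Rightarrow> (real \<Rightarrow> real) measure"
  where "fin_dim_law M X J = distr M (PiM J (\<lambda>_. borel)) (\<lambda>\<omega>. \<lambda>t\<in>J. X t \<omega>)"

definition weakly_converges :: "'b topology \<Rightarrow> (nat \<Rightarrow> 'b measure) \<Rightarrow> 'b measure \<Rightarrow> bool" where
  "weakly_converges T \<mu> \<nu> \<longleftrightarrow>
     (\<forall>f. continuous_map T euclideanreal f \<and> bounded (f ` topspace T) \<longrightarrow>
        (\<lambda>n. LINT x|\<mu> n. f x) \<longlonglongrightarrow> (LINT x|\<nu>. f x))"

definition fdd_converges ::
  "real set \<Rightarrow> (nat \<Rightarrow> 'a measure) \<Rightarrow> (nat \<Rightarrow> real \<Rightarrow> 'a \<Rightarrow> real) \<Rightarrow>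
   'b measure \<Rightarrow> (real \<Rightarrow> 'b \<Rightarrow> real) \<Rightarrow> bool" where
  "fdd_converges I M X N Y \<longleftrightarrow>
     (\<forall>J. finite J \<and> J \<subseteq> I \<longrightarrow>
        weakly_converges (product_topology (\<lambda>_. euclideanreal) J)
          (\<lambda>n. fin_dim_law (M n) (X n) J) (fin_dim_law N Y J))"

end

theory Submission
  imports Defs
begin

text \<open>
  A \<open>{0, 1}\<close>-valued process has convergent finite-dimensional laws as soon as the probabilities of
  being 1 on a finite set of times converge. Given that the passengers are detached at time \<open>k\<close>,
  they are detached at time \<open>l > k\<close> iff those who move in \<open>(k, l]\<close> end up in distinct buses, and
  this event depends only on relocations in \<open>(k, l]\<close>. Hence the probability of detachment at several
  times is a product over successive times. The number of movers is binomial and each mover is uniform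
  on \<open>l - k\<close> buses, so for \<open>k \<sim> a n\<^sup>2\<close> and \<open>l \<sim> b n\<^sup>2\<close> Bernstein's theorem shows that the
  factor tends to \<open>exp (- (b - a) / (2 b\<^sup>2))\<close>.

  In the limit, pairs of passengers share a bus during random intervals forming a Poisson process.
  Those that meet \<open>[1, \<infinity>)\<close> have total intensity 1, and they are distributed as \<open>[V / U, 1 / U)\<close> with
  \<open>U\<close> and \<open>V\<close> independent and uniform on \<open>[0, 1]\<close>. The limit process is therefore explicit: take a
  Poisson(1) number of such intervals and let the process be 1 outside their union.
\<close>

subsection \<open>Finite-dimensional convergence of indicator processes\<close>

text \<open>For functions on the uncountable type \<open>real\<close>, the Borel sets are not the
  product sigma-algebra. So \<open>J\<close> is embedded in \<open>nat\<close>, where the two agree: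
  \<open>f\<close> factors as a continuous function \<open>F\<close> on
  \<open>nat \<Rightarrow> real\<close> after a measurable re-indexing.\<close>

lemma continuous_map_product_borel_measurable:
  fixes f :: "(real \<Rightarrow> real) \<Rightarrow> real"
  assumes "finite J" and f: "continuous_map (product_topology (\<lambda>_. euclideanreal) J) euclideanreal f"
  shows "f \<in> borel_measurable (PiM J (\<lambda>_. borel))"
proof -
  obtain e :: "real \<Rightarrow> nat" where e: "inj_on e J"
    using assms(1) finite_imp_inj_to_nat_seg by metis
  define F where "F = (\<lambda>x :: nat \<Rightarrow> real. f (\<lambda>t\<in>J. x (e t)))"
  have "continuous_map (product_topology (\<lambda>_. euclideanreal) UNIV)
      (product_topology (\<lambda>_. euclideanreal) J) (\<lambda>x :: nat \<Rightarrow> real. \<lambda>t\<in>J. x (e t))"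
    by (auto simp: continuous_map_componentwise intro!: continuous_map_product_projection)
  from continuous_map_compose[OF this f]
  have "continuous_map euclidean euclideanreal F"
    by (simp add: F_def o_def euclidean_product_topology)
  then have "continuous_on UNIV F"
    by simp
  then have F: "F \<in> borel_measurable borel"
    by (rule borel_measurable_continuous_onI)
  have m: "(\<lambda>y i. if i \<in> e ` J then y (inv_into J e i) else 0)
      \<in> measurable (PiM J (\<lambda>_. borel)) (borel :: (nat \<Rightarrow> real) measure)"
    unfolding measurable_cong_sets[OF refl sets_PiM_equal_borel[symmetric]]
  proof (rule measurable_PiM_single')
    fix i :: nat
    show "(\<lambda>y. if i \<in> e ` J then y (inv_into J e i) else 0) \<in> borel_measurable (PiM J (\<lambda>_. borel))"
      by (cases "i \<in> e ` J") (auto simp: inv_into_into intro!: measurable_component_singleton)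
  qed auto
  have "f y = F (\<lambda>i. if i \<in> e ` J then y (inv_into J e i) else 0)"
    if "y \<in> space (PiM J (\<lambda>_. borel))" for y
    using that e
    by (auto simp: F_def space_PiM PiE_def extensional_def fun_eq_iff intro!: arg_cong[of _ _ f])
  then show ?thesis
    using measurable_compose[OF m F] by (simp cong: measurable_cong)
qed

text \<open>The sample space is partitioned according to the set \<open>U\<close> of times in
  \<open>J\<close> at which the process is 1, and the test function is constant on each
  cell.\<close>

lemma integral_fin_dim_law_01:
  fixes X :: "real \<Rightarrow> 'a \<Rightarrow> real"
  assumes "prob_space M" and J: "finite J"
    and X: "\<And>t. t \<in> J \<Longrightarrow> X t \<in> borel_measurable M"
    and X01: "\<And>t \<omega>. X t \<omega> = 0 \<or> X t \<omega> = 1"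
    and f: "continuous_map (product_topology (\<lambda>_. euclideanreal) J) euclideanreal f"
  shows "(LINT x|fin_dim_law M X J. f x) = (\<Sum>U\<in>Pow J.
     measure M {\<omega> \<in> space M. (\<forall>t\<in>U. X t \<omega> = 1) \<and> (\<forall>t\<in>J - U. X t \<omega> \<noteq> 1)} *
       f (\<lambda>t\<in>J. indicator U t))"
proof -
  interpret prob_space M by fact
  define E where "E = (\<lambda>U. {\<omega> \<in> space M. (\<forall>t\<in>U. X t \<omega> = 1) \<and> (\<forall>t\<in>J - U. X t \<omega> \<noteq> 1)})"
  have E: "E U \<in> events" if "U \<in> Pow J" for U
  proof -
    have "{\<omega> \<in> space M. X t \<omega> = 1} \<in> events" if "t \<in> J" for t
      using X[OF that] by measurable
    then show ?thesis
      unfolding E_def using J that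
      by (intro sets.sets_Collect_conj sets.sets_Collect_finite_All sets.sets_Collect_neg)
        (auto intro: finite_subset)
  qed
  have "(LINT x|fin_dim_law M X J. f x) = (LINT \<omega>|M. f (\<lambda>t\<in>J. X t \<omega>))"
    unfolding fin_dim_law_def
    by (rule integral_distr)
      (auto intro!: measurable_restrict X continuous_map_product_borel_measurable J f)
  also have "\<dots> = (LINT \<omega>|M. (\<Sum>U\<in>Pow J. indicator (E U) \<omega> * f (\<lambda>t\<in>J. indicator U t)))"
  proof (rule Bochner_Integration.integral_cong[OF refl])
    fix \<omega> assume \<omega>: "\<omega> \<in> space M"
    let ?W = "{t \<in> J. X t \<omega> = 1}"
    have "\<omega> \<in> E U \<longleftrightarrow> U = ?W" if "U \<in> Pow J" for U
      using \<omega> that by (auto simp: E_def)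
    then have "(\<Sum>U\<in>Pow J. indicator (E U) \<omega> * f (\<lambda>t\<in>J. indicator U t)) =
        (\<Sum>U\<in>Pow J. if U = ?W then f (\<lambda>t\<in>J. indicator U t) else 0)"
      by (intro sum.cong) (auto simp: indicator_def)
    also have "\<dots> = f (\<lambda>t\<in>J. indicator ?W t)"
      using J by (subst sum.delta) auto
    also have "(\<lambda>t\<in>J. indicator ?W t) = (\<lambda>t\<in>J. X t \<omega>)"
      using X01 by (fastforce simp: fun_eq_iff indicator_def)
    finally show "f (\<lambda>t\<in>J. X t \<omega>) = (\<Sum>U\<in>Pow J. indicator (E U) \<omega> * f (\<lambda>t\<in>J. indicator U t))"
      by (rule sym)
  qed
  also have "\<dots> = (\<Sum>U\<in>Pow J. measure M (E U) * f (\<lambda>t\<in>J. indicator U t))"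
    using E by (subst Bochner_Integration.integral_sum)
      (auto intro!: integrable_mult_left integrable_real_indicator simp: emeasure_eq_measure)
  finally show ?thesis by (simp add: E_def)
qed

text \<open>By inclusion-exclusion, the probability of every 0/1 pattern is a signed sum of
  probabilities of being 1 throughout a finite set, so convergence of the latter carries over to
  each cell of the partition.\<close>

lemma fdd_converges_01I:
  fixes X :: "nat \<Rightarrow> real \<Rightarrow> 'a \<Rightarrow> real" and Y :: "real \<Rightarrow> 'b \<Rightarrow> real"
  assumes M: "\<And>n. n \<ge> 1 \<Longrightarrow> prob_space (M n)"
    and X: "\<And>n t. n \<ge> 1 \<Longrightarrow> t \<in> I \<Longrightarrow> X n t \<in> borel_measurable (M n)"
    and X01: "\<And>n t \<omega>. X n t \<omega> = 0 \<or> X n t \<omega> = 1"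
    and N: "prob_space N"
    and Y: "\<And>t. t \<in> I \<Longrightarrow> Y t \<in> borel_measurable N"
    and Y01: "\<And>t \<omega>. Y t \<omega> = 0 \<or> Y t \<omega> = 1"
    and conv: "\<And>U. finite U \<Longrightarrow> U \<subseteq> I \<Longrightarrow>
      (\<lambda>n. measure (M n) {\<omega> \<in> space (M n). \<forall>t\<in>U. X n t \<omega> = 1})
        \<longlonglongrightarrow> measure N {\<omega> \<in> space N. \<forall>t\<in>U. Y t \<omega> = 1}"
  shows "fdd_converges I M X N Y"
proof -
  \<comment> \<open>One constraint of being different from 1 is traded for a difference of two
    probabilities with fewer such constraints. The process is generic because this serves both
    \<open>X n\<close> and \<open>Y\<close>.\<close>
  have split: "measure M {\<omega> \<in> space M. (\<forall>t\<in>U. X t \<omega> = 1) \<and> (\<forall>t\<in>insert v V. X t \<omega> \<noteq> 1)} =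
      measure M {\<omega> \<in> space M. (\<forall>t\<in>U. X t \<omega> = 1) \<and> (\<forall>t\<in>V. X t \<omega> \<noteq> 1)} -
      measure M {\<omega> \<in> space M. (\<forall>t\<in>insert v U. X t \<omega> = 1) \<and> (\<forall>t\<in>V. X t \<omega> \<noteq> 1)}"
    if "prob_space M" "finite U" "finite V" "\<And>t. t \<in> insert v (U \<union> V) \<Longrightarrow> X t \<in> borel_measurable M"
    for M :: "'c measure" and X :: "real \<Rightarrow> 'c \<Rightarrow> real" and U V v
  proof -
    interpret prob_space M by fact
    have [measurable]: "t \<in> U \<Longrightarrow> X t \<in> borel_measurable M" "t \<in> V \<Longrightarrow> X t \<in> borel_measurable M"
       "t \<in> insert v U \<Longrightarrow> X t \<in> borel_measurable M" for t
      using that(4) by auto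
    show ?thesis using that(2,3)
      by (subst finite_measure_Diff[symmetric]) (auto intro!: arg_cong[of _ _ prob])
  qed
  have conv2: "(\<lambda>n. measure (M n) {\<omega> \<in> space (M n). (\<forall>t\<in>U. X n t \<omega> = 1) \<and> (\<forall>t\<in>V. X n t \<omega> \<noteq> 1)})
        \<longlonglongrightarrow> measure N {\<omega> \<in> space N. (\<forall>t\<in>U. Y t \<omega> = 1) \<and> (\<forall>t\<in>V. Y t \<omega> \<noteq> 1)}"
    if "finite V" "finite U" "U \<subseteq> I" "V \<subseteq> I" for U V
    using that
  proof (induction V arbitrary: U rule: finite_induct)
    case empty
    then show ?case using conv by simp
  next
    case (insert v V)
    have "eventually (\<lambda>n :: nat. n \<ge> 1) sequentially"
      by (rule eventually_ge_at_top)
    then have ev: "\<forall>\<^sub>F n in sequentially.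
      measure (M n) {\<omega> \<in> space (M n). (\<forall>t\<in>U. X n t \<omega> = 1) \<and> (\<forall>t\<in>V. X n t \<omega> \<noteq> 1)} -
      measure (M n) {\<omega> \<in> space (M n). (\<forall>t\<in>insert v U. X n t \<omega> = 1) \<and> (\<forall>t\<in>V. X n t \<omega> \<noteq> 1)} =
      measure (M n) {\<omega> \<in> space (M n). (\<forall>t\<in>U. X n t \<omega> = 1) \<and> (\<forall>t\<in>insert v V. X n t \<omega> \<noteq> 1)}"
      by eventually_elim
        (rule split[symmetric], use M X insert.prems insert.hyps in auto)
    have "measure N {\<omega> \<in> space N. (\<forall>t\<in>U. Y t \<omega> = 1) \<and> (\<forall>t\<in>insert v V. Y t \<omega> \<noteq> 1)} =
      measure N {\<omega> \<in> space N. (\<forall>t\<in>U. Y t \<omega> = 1) \<and> (\<forall>t\<in>V. Y t \<omega> \<noteq> 1)} -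
      measure N {\<omega> \<in> space N. (\<forall>t\<in>insert v U. Y t \<omega> = 1) \<and> (\<forall>t\<in>V. Y t \<omega> \<noteq> 1)}"
      by (rule split) (use N Y insert.prems insert.hyps in auto)
    moreover have "(\<lambda>n.
      measure (M n) {\<omega> \<in> space (M n). (\<forall>t\<in>U. X n t \<omega> = 1) \<and> (\<forall>t\<in>V. X n t \<omega> \<noteq> 1)} -
      measure (M n) {\<omega> \<in> space (M n). (\<forall>t\<in>insert v U. X n t \<omega> = 1) \<and> (\<forall>t\<in>V. X n t \<omega> \<noteq> 1)})
      \<longlonglongrightarrow>
      measure N {\<omega> \<in> space N. (\<forall>t\<in>U. Y t \<omega> = 1) \<and> (\<forall>t\<in>V. Y t \<omega> \<noteq> 1)} -
      measure N {\<omega> \<in> space N. (\<forall>t\<in>insert v U. Y t \<omega> = 1) \<and> (\<forall>t\<in>V. Y t \<omega> \<noteq> 1)}"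
      using insert.prems by (intro tendsto_diff insert.IH) auto
    ultimately show ?case
      using Lim_transform_eventually[OF _ ev] by simp
  qed
  show ?thesis
    unfolding fdd_converges_def weakly_converges_def
  proof (intro allI impI, elim conjE)
    fix J f
    assume J: "finite J" "J \<subseteq> I"
      and f: "continuous_map (product_topology (\<lambda>_. euclideanreal) J) euclideanreal f"
    define S where "S = (\<lambda>n. \<Sum>U\<in>Pow J.
      measure (M n) {\<omega> \<in> space (M n). (\<forall>t\<in>U. X n t \<omega> = 1) \<and> (\<forall>t\<in>J - U. X n t \<omega> \<noteq> 1)} *
       f (\<lambda>t\<in>J. indicator U t))"
    have "S \<longlonglongrightarrow> (LINT x|fin_dim_law N Y J. f x)"
      unfolding S_def using J X01 Y01 Y N f
      by (subst integral_fin_dim_law_01)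
        (auto intro!: tendsto_sum tendsto_mult conv2 intro: finite_subset)
    moreover have "eventually (\<lambda>n :: nat. n \<ge> 1) sequentially"
      by (rule eventually_ge_at_top)
    then have "\<forall>\<^sub>F n in sequentially. S n = (LINT x|fin_dim_law (M n) (X n) J. f x)"
      unfolding S_def
      by eventually_elim (rule integral_fin_dim_law_01[symmetric], use M X X01 J f in auto)
    ultimately show "(\<lambda>n. LINT x|fin_dim_law (M n) (X n) J. f x) \<longlonglongrightarrow> (LINT x|fin_dim_law N Y J. f x)"
      by (rule Lim_transform_eventually)
  qed
qed

subsection \<open>Asymptotics of the detachment probabilities\<close>

text \<open>\<open>Bernstein n w p\<close> is the binomial probability of \<open>w\<close> movers
  among \<open>n\<close>, and the product is the birthday probability that \<open>w\<close> uniform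
  choices among \<open>l - k\<close> buses are distinct; it vanishes for
  \<open>w > l - k\<close>.\<close>

definition distinct_movers_prob :: "nat \<Rightarrow> nat \<Rightarrow> nat \<Rightarrow> real" where
  "distinct_movers_prob n k l = (\<Sum>w\<le>n. (\<Prod>i<w. 1 - real i / real (l - k)) *
     Bernstein n w (real (l - k) / real l))"

text \<open>Each factor is compared with \<open>exp (- i / m)\<close>; the product of these is
  \<open>exp (- w (w - 1) / (2 m))\<close>, which is compared with its form for
  \<open>m \<sim> c n\<^sup>2\<close>. The bound does not depend on \<open>w\<close>, so it survives
  averaging over the number of movers.\<close>

lemma prod_one_minus_approx:
  fixes m c :: real and n w :: nat
  assumes m: "m \<ge> real n" "m > 0" and c: "c > 0" and n: "n > 0" and w: "w \<le> n"
  shows "\<bar>(\<Prod>i<w. 1 - real i / m) - exp (- (real w / real n)\<^sup>2 / (2 * c))\<bar>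
    \<le> real n ^ 3 / m\<^sup>2 + (1 / 2) * \<bar>real n ^ 2 / m - 1 / c\<bar> + real n / (2 * m)"
proof -
  have im: "real i / m \<le> 1" if "i < w" for i
    using that w m by (simp add: divide_simps)
  \<comment> \<open>All factors lie in the unit interval, so errors of single factors add up without
    amplification.\<close>
  have "norm ((\<Prod>i<w. 1 - real i / m) - (\<Prod>i<w. exp (- (real i / m))))
      \<le> (\<Sum>i<w. norm ((1 - real i / m) - exp (- (real i / m))))"
  proof (rule norm_prod_diff)
    show "norm (1 - real i / m) \<le> 1" if "i \<in> {..<w}" for i
      using im[of i] that m by auto
  qed (use m in auto)
  then have "\<bar>(\<Prod>i<w. 1 - real i / m) - (\<Prod>i<w. exp (- (real i / m)))\<bar>
      \<le> (\<Sum>i<w. \<bar>(1 - real i / m) - exp (- (real i / m))\<bar>)"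
    by simp
  also have "\<dots> \<le> (\<Sum>i<w. (real n / m)\<^sup>2)"
  proof (rule sum_mono)
    fix i assume i: "i \<in> {..<w}"
    let ?x = "real i / m"
    have x: "0 \<le> ?x" using m by simp
    have "1 - ?x \<le> exp (- ?x)" using exp_ge_add_one_self[of "-?x"] by simp
    \<comment> \<open>After multiplication by \<open>1 + ?x\<close>, the left side is at most 1 and
      the right side is \<open>1 + ?x ^ 3\<close>.\<close>
    moreover have "exp (- ?x) \<le> 1 - ?x + ?x\<^sup>2"
    proof -
      have "exp (- ?x) * (1 + ?x) \<le> exp (- ?x) * exp ?x"
        by (intro mult_left_mono) (auto simp: exp_ge_add_one_self)
      then have "exp (- ?x) * (1 + ?x) \<le> 1" by (simp add: exp_minus_inverse mult.commute)
      moreover have "(1 - x + x\<^sup>2) * (1 + x) = 1 + x ^ 3" for x :: real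
        by (simp add: algebra_simps power2_eq_square power3_eq_cube)
      moreover have "0 \<le> ?x ^ 3" using x by simp
      ultimately have "exp (- ?x) * (1 + ?x) \<le> (1 - ?x + ?x\<^sup>2) * (1 + ?x)"
        by (smt (verit))
      then show ?thesis using x by (metis add_pos_nonneg mult_le_cancel_right_pos zero_less_one)
    qed
    moreover have "?x\<^sup>2 \<le> (real n / m)\<^sup>2"
      using i w m by (intro power_mono divide_right_mono) auto
    ultimately show "\<bar>(1 - ?x) - exp (- ?x)\<bar> \<le> (real n / m)\<^sup>2"
      by (simp add: abs_le_iff)
  qed
  also have "\<dots> \<le> real n * (real n / m)\<^sup>2"
    using w by (simp add: mult_right_mono)
  also have "\<dots> = real n ^ 3 / m\<^sup>2"
    by (simp add: power2_eq_square power3_eq_cube)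
  finally have 1: "\<bar>(\<Prod>i<w. 1 - real i / m) - (\<Prod>i<w. exp (- (real i / m)))\<bar> \<le> real n ^ 3 / m\<^sup>2" .

  have gauss: "(\<Sum>i<w. real i) = real w * (real w - 1) / 2"
    by (induction w) (auto simp: field_simps)
  have e: "(\<Prod>i<w. exp (- (real i / m))) = exp (- (real w * (real w - 1) / (2 * m)))"
    by (simp add: exp_sum[symmetric] sum_negf sum_divide_distrib[symmetric] gauss)
  have lip: "\<bar>exp (- x) - exp (- y)\<bar> \<le> \<bar>x - y\<bar>" if "x \<ge> 0" "y \<ge> 0" for x y :: real
  proof -
    have *: "\<bar>exp (- x) - exp (- y)\<bar> \<le> y - x" if "0 \<le> x" "x \<le> y" for x y :: real
    proof -
      have "exp (- y) \<le> exp (- x)" using that by auto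
      have "exp (- x) - exp (- y) = exp (- x) * (1 - exp (- (y - x)))"
        by (simp add: algebra_simps exp_add[symmetric])
      moreover have "1 - exp (- (y - x)) \<le> y - x"
        using exp_ge_add_one_self[of "- (y - x)"] by linarith
      then have "exp (- x) * (1 - exp (- (y - x))) \<le> 1 * (y - x)"
        using that by (intro mult_mono) auto
      ultimately have "exp (- x) - exp (- y) \<le> y - x" by (simp only: mult_1)
      with \<open>exp (- y) \<le> exp (- x)\<close> show ?thesis by linarith
    qed
    show ?thesis using *[of x y] *[of y x] that by linarith
  qed
  have ww: "real w * (real w - 1) \<ge> 0"
    by (cases w) auto
  have "\<bar>(\<Prod>i<w. exp (- (real i / m))) - exp (- (real w / real n)\<^sup>2 / (2 * c))\<bar>
      \<le> \<bar>real w * (real w - 1) / (2 * m) - (real w / real n)\<^sup>2 / (2 * c)\<bar>"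
    unfolding e using lip[of "real w * (real w - 1) / (2 * m)" "(real w / real n)\<^sup>2 / (2 * c)"] ww m c
    by simp
  \<comment> \<open>The quadratic term measures how far \<open>m / n\<^sup>2\<close> is from
    \<open>c\<close>; the linear remainder comes from \<open>w - 1\<close> in place of
    \<open>w\<close>.\<close>
  also have "real w * (real w - 1) / (2 * m) - (real w / real n)\<^sup>2 / (2 * c) =
      (real w / real n)\<^sup>2 * (1 / 2 * (real n ^ 2 / m - 1 / c)) - real w / (2 * m)"
    using n m c by (simp add: field_simps power2_eq_square)
  also have "\<bar>\<dots>\<bar> \<le> \<bar>(real w / real n)\<^sup>2 * (1 / 2 * (real n ^ 2 / m - 1 / c))\<bar> + \<bar>real w / (2 * m)\<bar>"
    by (rule abs_triangle_ineq4)
  also have "\<dots> \<le> (1 / 2) * \<bar>real n ^ 2 / m - 1 / c\<bar> + real n / (2 * m)"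
  proof (rule add_mono)
    have "(real w / real n)\<^sup>2 \<le> 1" using w n by (simp add: power_le_one)
    then have "(real w / real n)\<^sup>2 * \<bar>1 / 2 * (real n ^ 2 / m - 1 / c)\<bar>
        \<le> 1 * \<bar>1 / 2 * (real n ^ 2 / m - 1 / c)\<bar>"
      by (intro mult_right_mono) auto
    then show "\<bar>(real w / real n)\<^sup>2 * (1 / 2 * (real n ^ 2 / m - 1 / c))\<bar> \<le> 1 / 2 * \<bar>real n ^ 2 / m - 1 / c\<bar>"
      by (simp add: abs_mult)
    show "\<bar>real w / (2 * m)\<bar> \<le> real n / (2 * m)"
      using w m by (simp add: divide_right_mono)
  qed
  finally show ?thesis using 1 by linarith
qed

text \<open>Up to a uniform error the birthday probability is \<open>f (w / n)\<close>, so its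
  binomial average is close to the Bernstein polynomial of \<open>f\<close> at the moving
  probability \<open>p n\<close>, which tends to \<open>c / b\<close>. The case \<open>a = 0\<close>
  covers the first observation time.\<close>

lemma distinct_movers_prob_tendsto:
  fixes k l :: "nat \<Rightarrow> nat" and a b :: real
  assumes a: "(\<lambda>n. real (k n) / real n ^ 2) \<longlonglongrightarrow> a" and b: "(\<lambda>n. real (l n) / real n ^ 2) \<longlonglongrightarrow> b"
    and ab: "0 \<le> a" "a < b"
  shows "(\<lambda>n. distinct_movers_prob n (k n) (l n)) \<longlonglongrightarrow> exp (- (b - a) / (2 * b\<^sup>2))"
proof -
  define c where "c = b - a"
  have c: "c > 0" using ab by (simp add: c_def)
  define m where "m = (\<lambda>n. real (l n - k n))"
  define p where "p = (\<lambda>n. m n / real (l n))"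
  define f where "f = (\<lambda>x :: real. exp (- x\<^sup>2 / (2 * c)))"
  define \<epsilon> where "\<epsilon> = (\<lambda>n. real n ^ 3 / (m n)\<^sup>2 + (1 / 2) * \<bar>real n ^ 2 / m n - 1 / c\<bar> + real n / (2 * m n))"
  define q where "q = (\<lambda>n. distinct_movers_prob n (k n) (l n))"
  define B where "B = (\<lambda>n. \<Sum>w\<le>n. f (real w / real n) * Bernstein n w (p n))"
  have pos: "\<forall>\<^sub>F n :: nat in sequentially. n > 0" by (rule eventually_gt_at_top)
  have "(\<lambda>n. real (l n) / real n ^ 2 - real (k n) / real n ^ 2) \<longlonglongrightarrow> b - a"
    by (intro tendsto_intros a b)
  then have d: "(\<lambda>n. real (l n) / real n ^ 2 - real (k n) / real n ^ 2) \<longlonglongrightarrow> c"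
    by (simp add: c_def)
  have "\<forall>\<^sub>F n in sequentially. real (l n) / real n ^ 2 - real (k n) / real n ^ 2 > 0"
    using order_tendstoD(1)[OF d c] .
  then have kl: "\<forall>\<^sub>F n in sequentially. k n < l n"
    by eventually_elim (auto simp: diff_divide_distrib[symmetric] zero_less_divide_iff)
  have m: "(\<lambda>n. m n / real n ^ 2) \<longlonglongrightarrow> c"
    by (rule Lim_transform_eventually[OF d])
      (use kl in eventually_elim, auto simp: m_def diff_divide_distrib of_nat_diff)
  have "(\<lambda>n. (m n / real n ^ 2) / (real (l n) / real n ^ 2)) \<longlonglongrightarrow> c / b"
    using ab by (intro tendsto_divide m b) auto
  then have p: "p \<longlonglongrightarrow> c / b"
    by (rule Lim_transform_eventually) (use pos in eventually_elim, auto simp: p_def)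
  have im: "(\<lambda>n. real n ^ 2 / m n) \<longlonglongrightarrow> 1 / c"
    using tendsto_inverse[OF m] c by (simp add: inverse_eq_divide)
  have z: "(\<lambda>n. 1 / real n) \<longlonglongrightarrow> 0" by (rule lim_1_over_n)
  have "(\<lambda>n. 1 / real n * (real n ^ 2 / m n)^2 + (1 / 2) * \<bar>real n ^ 2 / m n - 1 / c\<bar> +
        1 / real n * (real n ^ 2 / m n) / 2) \<longlonglongrightarrow> 0 * (1 / c)^2 + (1/2) * \<bar>1 / c - 1 / c\<bar> + 0 * (1 / c) / 2"
    by (intro tendsto_intros im z) auto
  then have "(\<lambda>n. 1 / real n * (real n ^ 2 / m n)^2 + (1 / 2) * \<bar>real n ^ 2 / m n - 1 / c\<bar> +
        1 / real n * (real n ^ 2 / m n) / 2) \<longlonglongrightarrow> 0"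
    by simp
  then have \<epsilon>: "\<epsilon> \<longlonglongrightarrow> 0"
  proof (rule Lim_transform_eventually)
    show "\<forall>\<^sub>F n in sequentially. 1 / real n * (real n ^ 2 / m n)^2 + (1 / 2) * \<bar>real n ^ 2 / m n - 1 / c\<bar> +
        1 / real n * (real n ^ 2 / m n) / 2 = \<epsilon> n"
      using pos by eventually_elim (auto simp: \<epsilon>_def power2_eq_square power3_eq_cube)
  qed
  \<comment> \<open>\<open>m n\<close> is of order \<open>n\<^sup>2\<close>, hence eventually
    exceeds \<open>n\<close>, as the factorwise comparison requires.\<close>
  have mn: "\<forall>\<^sub>F n in sequentially. real n \<le> m n"
  proof -
    have "(\<lambda>n. 1 / real n * (real n ^ 2 / m n)) \<longlonglongrightarrow> 0 * (1 / c)"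
      by (intro tendsto_intros im z)
    then have "\<forall>\<^sub>F n in sequentially. 1 / real n * (real n ^ 2 / m n) < 1"
      by (intro order_tendstoD(2)) auto
    then show ?thesis using kl pos
      by eventually_elim (simp add: m_def field_simps power2_eq_square)
  qed
  have "\<forall>\<^sub>F n in sequentially. norm (q n - B n) \<le> \<epsilon> n"
    using mn kl pos
  proof eventually_elim
    case (elim n)
    have p01: "0 \<le> p n" "p n \<le> 1" using elim by (auto simp: p_def m_def)
    have "q n - B n = (\<Sum>w\<le>n. ((\<Prod>i<w. 1 - real i / m n) - f (real w / real n)) * Bernstein n w (p n))"
      by (simp add: q_def B_def distinct_movers_prob_def m_def p_def sum_subtractf algebra_simps)
    also have "norm \<dots> \<le> (\<Sum>w\<le>n. \<epsilon> n * Bernstein n w (p n))"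
    proof (rule sum_norm_le)
      fix w assume "w \<in> {..n}"
      then have "\<bar>(\<Prod>i<w. 1 - real i / m n) - f (real w / real n)\<bar> \<le> \<epsilon> n"
        using prod_one_minus_approx[of n "m n" c w] elim c by (simp add: f_def \<epsilon>_def)
      then show "norm (((\<Prod>i<w. 1 - real i / m n) - f (real w / real n)) * Bernstein n w (p n))
          \<le> \<epsilon> n * Bernstein n w (p n)"
        using Bernstein_nonneg[OF p01] by (auto simp: abs_mult intro!: mult_mono)
    qed
    also have "\<dots> = \<epsilon> n" by (simp flip: sum_distrib_left)
    finally show ?case .
  qed
  then have 1: "(\<lambda>n. q n - B n) \<longlonglongrightarrow> 0"
    using \<epsilon> by (rule Lim_null_comparison)
  \<comment> \<open>Bernstein approximation is uniform on the unit interval, so it may be applied at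
    the point \<open>p n\<close>, which varies with \<open>n\<close>.\<close>
  have 2: "(\<lambda>n. B n - f (p n)) \<longlonglongrightarrow> 0"
  proof (rule tendstoI)
    fix e :: real assume "e > 0"
    moreover have "continuous_on {0..1} f"
      unfolding f_def using c by (intro continuous_intros) auto
    ultimately obtain N0 where N0: "\<And>n x. N0 \<le> n \<Longrightarrow> x \<in> {0..1} \<Longrightarrow>
        \<bar>f x - (\<Sum>k\<le>n. f (k / n) * Bernstein n k x)\<bar> < e"
      using Bernstein_Weierstrass by metis
    show "\<forall>\<^sub>F n in sequentially. dist (B n - f (p n)) 0 < e"
      using eventually_ge_at_top[of N0] kl
    proof eventually_elim
      case (elim n)
      then have "p n \<in> {0..1}" by (auto simp: p_def m_def)
      from N0[OF elim(1) this] show ?case by (simp add: B_def dist_real_def abs_minus_commute)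
    qed
  qed
  have 3: "(\<lambda>n. f (p n)) \<longlonglongrightarrow> f (c / b)"
    unfolding f_def using c by (intro tendsto_intros p) auto
  have "(\<lambda>n. (q n - B n) + (B n - f (p n)) + f (p n)) \<longlonglongrightarrow> 0 + 0 + f (c / b)"
    by (intro tendsto_add 1 2 3)
  moreover have "f (c / b) = exp (- (b - a) / (2 * b\<^sup>2))"
    using c ab by (simp add: f_def c_def power2_eq_square field_simps)
  ultimately show ?thesis by (simp add: q_def)
qed

subsection \<open>The detachment process\<close>

lemma sum_Pow_card:
  fixes \<phi> :: "nat \<Rightarrow> real"
  assumes "finite I"
  shows "(\<Sum>W\<in>Pow I. \<phi> (card W)) = (\<Sum>w\<le>card I. real (card I choose w) * \<phi> w)"
proof -
  have "(\<Sum>W\<in>Pow I. \<phi> (card W)) = (\<Sum>w\<le>card I. \<Sum>W\<in>{W \<in> Pow I. card W = w}. \<phi> (card W))"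
    using assms by (intro sum.group[symmetric]) (auto intro: card_mono)
  also have "\<dots> = (\<Sum>w\<le>card I. real (card I choose w) * \<phi> w)"
    using n_subsets[OF assms] by (intro sum.cong) (auto simp: Pow_def)
  finally show ?thesis .
qed

text \<open>The value 0, being outside \<open>S\<close>, marks points where the map is undefined.
  Restriction to \<open>W\<close> is then a bijection onto the injections from \<open>W\<close> to
  \<open>S\<close>, with extension by 0 as inverse. In the falling factorial, truncated subtraction
  yields a zero factor when \<open>W\<close> is larger than \<open>S\<close>.\<close>

lemma card_injections_with_support:
  fixes S :: "nat set"
  assumes "finite I" "finite S" "0 \<notin> S" "W \<subseteq> I"
  shows "card {f \<in> I \<rightarrow>\<^sub>E insert 0 S. {i \<in> I. f i \<noteq> 0} = W \<and> inj_on f W}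
    = (\<Prod>i<card W. card S - i)"
proof -
  have W: "finite W" using assms finite_subset by auto
  let ?A = "{f \<in> I \<rightarrow>\<^sub>E insert 0 S. {i \<in> I. f i \<noteq> 0} = W \<and> inj_on f W}"
  let ?B = "{f \<in> W \<rightarrow>\<^sub>E S. inj_on f W}"
  have "bij_betw (\<lambda>f. restrict f W) ?A ?B"
  proof (rule bij_betw_byWitness[where f' = "\<lambda>f. \<lambda>i\<in>I. if i \<in> W then f i else 0"])
    show "\<forall>f\<in>?A. (\<lambda>i\<in>I. if i \<in> W then restrict f W i else 0) = f"
      by (auto simp: fun_eq_iff PiE_def extensional_def)
    show "\<forall>f\<in>?B. restrict (\<lambda>i\<in>I. if i \<in> W then f i else 0) W = f"
      using assms(4) by (auto simp: fun_eq_iff PiE_def extensional_def)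
    show "(\<lambda>f. restrict f W) ` ?A \<subseteq> ?B"
      by (auto simp: PiE_def Pi_def)
    show "(\<lambda>f. \<lambda>i\<in>I. if i \<in> W then f i else 0) ` ?B \<subseteq> ?A"
    proof (rule image_subsetI)
      fix f assume f: "f \<in> ?B"
      let ?g = "\<lambda>i\<in>I. if i \<in> W then f i else 0"
      have f': "f i \<in> S" "f i \<noteq> 0" if "i \<in> W" for i
      proof -
        show "f i \<in> S" using that f by auto
        then show "f i \<noteq> 0" using assms(3) by (cases "f i = 0") simp_all
      qed
      have g: "?g i = f i" if "i \<in> W" for i
        using that assms(4) by auto
      have "?g \<in> I \<rightarrow>\<^sub>E insert 0 S"
        using f'(1) by auto
      moreover have "{i \<in> I. ?g i \<noteq> 0} = W"
        using f'(2) assms(4) by auto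
      moreover have "inj_on ?g W"
        using f g by (simp add: inj_on_def)
      ultimately show "?g \<in> ?A" by blast
    qed
  qed
  then have "card ?A = card ?B" by (rule bij_betw_same_card)
  also have "\<dots> = (\<Prod>i<card W. card S - i)"
    using card_inj_on_subset_funcset[OF W assms(2) order_refl] by (simp add: lessThan_atLeast0)
  finally show ?thesis .
qed

text \<open>Maps are grouped by their support \<open>W\<close>. All maps with the same support have
  the same weight, and both weight and count depend on \<open>W\<close> only through its
  size.\<close>

lemma sum_prod_partial_injections:
  fixes S :: "nat set" and a b :: real
  assumes I: "finite I" and S: "finite S" "0 \<notin> S"
  shows "(\<Sum>f\<in>{f \<in> I \<rightarrow>\<^sub>E insert 0 S. inj_on f {i \<in> I. f i \<noteq> 0}}. \<Prod>i\<in>I. if f i = 0 then a else b)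
    = (\<Sum>w\<le>card I. real (card I choose w) * ((\<Prod>i<w. real (card S - i)) * b ^ w * a ^ (card I - w)))"
    (is "sum ?g ?F = _")
proof -
  have F: "finite ?F"
    using I S by (intro finite_subset[OF _ finite_PiE[of I "\<lambda>_. insert 0 S"]]) auto
  have "sum ?g ?F = (\<Sum>W\<in>Pow I. \<Sum>f\<in>{f \<in> ?F. {i \<in> I. f i \<noteq> 0} = W}. ?g f)"
    using I by (intro sum.group[symmetric] F) auto
  also have "\<dots> = (\<Sum>W\<in>Pow I. (\<Prod>i<card W. real (card S - i)) * b ^ card W * a ^ (card I - card W))"
  proof (rule sum.cong[OF refl])
    fix W assume "W \<in> Pow I"
    then have W: "W \<subseteq> I" "finite W" using I finite_subset by auto
    have "?g f = b ^ card W * a ^ (card I - card W)" if "{i \<in> I. f i \<noteq> 0} = W" for f :: "'a \<Rightarrow> nat"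
    proof -
      have "?g f = (\<Prod>i\<in>I. if i \<in> W then b else a)"
        using that by (intro prod.cong) auto
      also have "\<dots> = (\<Prod>i\<in>W. b) * (\<Prod>i\<in>I - W. a)"
        using I W by (simp add: prod.If_cases Int_absorb1 Diff_eq)
      finally show ?thesis using W by (simp add: card_Diff_subset)
    qed
    then have "(\<Sum>f\<in>{f \<in> ?F. {i \<in> I. f i \<noteq> 0} = W}. ?g f) =
        real (card {f \<in> ?F. {i \<in> I. f i \<noteq> 0} = W}) * (b ^ card W * a ^ (card I - card W))"
      by simp
    also have "real (card {f \<in> ?F. {i \<in> I. f i \<noteq> 0} = W}) = (\<Prod>i<card W. real (card S - i))"
    proof -
      have "{f \<in> ?F. {i \<in> I. f i \<noteq> 0} = W} =
          {f \<in> I \<rightarrow>\<^sub>E insert 0 S. {i \<in> I. f i \<noteq> 0} = W \<and> inj_on f W}"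
        by auto
      then show ?thesis
        by (simp only: card_injections_with_support[OF I S W(1)] of_nat_prod)
    qed
    finally show "(\<Sum>f\<in>{f \<in> ?F. {i \<in> I. f i \<noteq> 0} = W}. ?g f) =
        (\<Prod>i<card W. real (card S - i)) * b ^ card W * a ^ (card I - card W)"
      by (simp only: mult.assoc)
  qed
  also have "\<dots> = (\<Sum>w\<le>card I. real (card I choose w) * ((\<Prod>i<w. real (card S - i)) * b ^ w * a ^ (card I - w)))"
    by (rule sum_Pow_card[OF I])
  finally show ?thesis .
qed

text \<open>
  The last relocation time in \<open>(k, l]\<close>, or 0 if there is none. Boarding bus 1 at time 1 counts as a
  relocation, so that \<open>last_move R 0 i l\<close> is the bus at time \<open>l \<ge> 1\<close>.
\<close>

primrec last_move :: "(nat \<Rightarrow> nat \<Rightarrow> 'a \<Rightarrow> bool) \<Rightarrow> nat \<Rightarrow> nat \<Rightarrow> nat \<Rightarrow> 'a \<Rightarrow> nat" where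
  "last_move R k i 0 \<omega> = 0"
| "last_move R k i (Suc l) \<omega> =
     (if Suc l \<le> k then 0 else if l = 0 \<or> R (Suc l) i \<omega> then Suc l else last_move R k i l \<omega>)"

definition distinct_movers :: "nat \<Rightarrow> (nat \<Rightarrow> nat \<Rightarrow> 'a \<Rightarrow> bool) \<Rightarrow> nat \<Rightarrow> nat \<Rightarrow> 'a \<Rightarrow> bool" where
  "distinct_movers n R k l \<omega> \<longleftrightarrow>
     inj_on (\<lambda>i. last_move R k i l \<omega>) {i \<in> {1..n}. last_move R k i l \<omega> \<noteq> 0}"

definition detached :: "nat \<Rightarrow> (nat \<Rightarrow> nat \<Rightarrow> 'a \<Rightarrow> bool) \<Rightarrow> nat \<Rightarrow> 'a \<Rightarrow> bool" where
  "detached n R l \<omega> \<longleftrightarrow> inj_on (\<lambda>i. bus R i l \<omega>) {1..n}"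

section \<open>Buses, last moves and detachment along a fixed path\<close>

lemma last_move_cases:
  "last_move R k i l \<omega> = 0 \<or> k < last_move R k i l \<omega> \<and> last_move R k i l \<omega> \<le> l"
  by (induction l) auto

lemma last_move_le [simp]: "l \<le> k \<Longrightarrow> last_move R k i l \<omega> = 0"
  by (cases l) auto

lemma bus_le: "1 \<le> l \<Longrightarrow> bus R i l \<omega> \<le> l"
proof (induction l)
  case (Suc l)
  then show ?case by (cases "l = 0") (auto simp: bus.simps[of R i "Suc l"] bus.simps[of R i "Suc 0"])
qed simp

lemma last_move_pos: "1 \<le> l \<Longrightarrow> last_move R 0 i l \<omega> \<noteq> 0"
proof (induction l)
  case (Suc l)
  then show ?case by (cases "l = 0") auto
qed simp

lemma bus_eq_last_move:
  assumes "k \<le> l"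
  shows "bus R i l \<omega> = (if last_move R k i l \<omega> = 0 then bus R i k \<omega> else last_move R k i l \<omega>)"
  using assms
proof (induction l rule: dec_induct)
  case (step l)
  then show ?case by (cases "l = 0") (auto simp: bus.simps[of R i "Suc l"] bus.simps[of R i "Suc 0"])
qed simp

text \<open>Boarding at time 1 counts as a move, so from time 0 on everybody is a mover. The first
  observation time is thereby treated like the later ones.\<close>

lemma detached_first:
  assumes "1 \<le> l"
  shows "detached n R l \<omega> \<longleftrightarrow> distinct_movers n R 0 l \<omega>"
proof -
  have "{i \<in> {1..n}. last_move R 0 i l \<omega> \<noteq> 0} = {1..n}"
    using last_move_pos[OF assms] by auto
  moreover have "bus R i l \<omega> = last_move R 0 i l \<omega>" for i
    using bus_eq_last_move[of 0 l R i \<omega>] last_move_pos[OF assms, of R i \<omega>] by simp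
  ultimately show ?thesis
    by (simp only: detached_def distinct_movers_def)
qed

text \<open>Those who stay are in buses numbered at most \<open>k\<close>, pairwise distinct by
  assumption, and movers are in buses beyond \<open>k\<close>. Hence two passengers can share a bus
  at time \<open>l\<close> only if both moved.\<close>

lemma detached_step:
  assumes "1 \<le> k" "k \<le> l" "detached n R k \<omega>"
  shows "detached n R l \<omega> \<longleftrightarrow> distinct_movers n R k l \<omega>"
proof
  assume D: "detached n R l \<omega>"
  show "distinct_movers n R k l \<omega>"
    unfolding distinct_movers_def
  proof (rule inj_onI)
    fix i j
    assume i: "i \<in> {i \<in> {1..n}. last_move R k i l \<omega> \<noteq> 0}"
      and j: "j \<in> {i \<in> {1..n}. last_move R k i l \<omega> \<noteq> 0}"
      and "last_move R k i l \<omega> = last_move R k j l \<omega>"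
    then have "bus R i l \<omega> = bus R j l \<omega>"
      using bus_eq_last_move[OF assms(2), of R i \<omega>] bus_eq_last_move[OF assms(2), of R j \<omega>] by simp
    then show "i = j"
      by (rule inj_onD[OF D[unfolded detached_def]]) (use i j in blast)+
  qed
next
  assume D: "distinct_movers n R k l \<omega>"
  show "detached n R l \<omega>"
    unfolding detached_def
  proof (rule inj_onI)
    fix i j assume ij: "i \<in> {1..n}" "j \<in> {1..n}" "bus R i l \<omega> = bus R j l \<omega>"
    have *: "last_move R k i l \<omega> = 0 \<longleftrightarrow> last_move R k j l \<omega> = 0"
      using ij(3) last_move_cases[of R k i l \<omega>] last_move_cases[of R k j l \<omega>]
        bus_eq_last_move[OF assms(2), of R i \<omega>] bus_eq_last_move[OF assms(2), of R j \<omega>]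
        bus_le[OF assms(1), of R i \<omega>] bus_le[OF assms(1), of R j \<omega>]
      by (auto split: if_splits)
    show "i = j"
    proof (cases "last_move R k i l \<omega> = 0")
      case True
      then have "bus R i k \<omega> = bus R j k \<omega>"
        using * ij(3) bus_eq_last_move[OF assms(2), of R i \<omega>]
          bus_eq_last_move[OF assms(2), of R j \<omega>] by simp
      then show ?thesis
        using ij(1,2) by (rule inj_onD[OF assms(3)[unfolded detached_def]])
    next
      case False
      then have "last_move R k i l \<omega> = last_move R k j l \<omega>"
        using * ij(3) bus_eq_last_move[OF assms(2), of R i \<omega>]
          bus_eq_last_move[OF assms(2), of R j \<omega>] by simp
      moreover have "last_move R k j l \<omega> \<noteq> 0" using False * by simp
      then have "i \<in> {i \<in> {1..n}. last_move R k i l \<omega> \<noteq> 0}"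
        "j \<in> {i \<in> {1..n}. last_move R k i l \<omega> \<noteq> 0}"
        using ij(1,2) False by simp_all
      ultimately show ?thesis
        by (rule inj_onD[OF D[unfolded distinct_movers_def]])
    qed
  qed
qed

lemma lonely_eq_iff_detached:
  "lonely n R t \<omega> = n \<longleftrightarrow> detached n R (nat \<lfloor>t\<rfloor>) \<omega>"
proof -
  let ?L = "{i \<in> {1..n}. \<forall>j \<in> {1..n}. j \<noteq> i \<longrightarrow> bus_at R j t \<omega> \<noteq> bus_at R i t \<omega>}"
  have "card ?L = n \<longleftrightarrow> ?L = {1..n}"
  proof
    assume "card ?L = n"
    then show "?L = {1..n}"
      by (intro card_subset_eq) auto
  next
    assume "?L = {1..n}"
    then show "card ?L = n" by (simp only: card_atLeastAtMost diff_Suc_1)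
  qed
  also have "\<dots> \<longleftrightarrow> detached n R (nat \<lfloor>t\<rfloor>) \<omega>"
    unfolding detached_def inj_on_def bus_at_def by blast
  finally show ?thesis unfolding lonely_def .
qed

section \<open>Independence and the law of the last moves\<close>

context detachment_process
begin

definition relocation_sigma :: "(nat \<times> nat) set \<Rightarrow> 'a measure" where
  "relocation_sigma B = sigma (space M) ((\<lambda>(k, i). {\<omega> \<in> space M. R k i \<omega>}) ` B)"

lemma space_relocation_sigma [simp]: "space (relocation_sigma B) = space M"
  unfolding relocation_sigma_def by (rule space_measure_of) auto

lemma sets_relocation_sigma:
  "sets (relocation_sigma B) = sigma_sets (space M) ((\<lambda>(k, i). {\<omega> \<in> space M. R k i \<omega>}) ` B)"
  unfolding relocation_sigma_def by (rule sets_measure_of) auto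

text \<open>A single event is an intersection-stable generator, so independence of the relocation
  events passes to the sigma-algebras generated by disjoint blocks of them.\<close>

lemma prob_INT_relocation_sigma:
  assumes J: "finite J" "J \<noteq> {}" and B: "\<And>j. j \<in> J \<Longrightarrow> B j \<subseteq> {2::nat..} \<times> {1..n}"
    and disj: "disjoint_family_on B J"
    and E: "\<And>j. j \<in> J \<Longrightarrow> E j \<in> sets (relocation_sigma (B j))"
  shows "prob (\<Inter>j\<in>J. E j) = (\<Prod>j\<in>J. prob (E j))"
proof -
  let ?A = "\<lambda>(k, i). {\<omega> \<in> space M. R k i \<omega>}"
  have "indep_sets (\<lambda>x. {?A x}) (\<Union>j\<in>J. B j)"
    using indep_relocations B unfolding indep_events_def_alt
    by (rule_tac indep_sets_mono_index) auto
  then have "indep_sets (\<lambda>j. sigma_sets (space M) (\<Union>x\<in>B j. {?A x})) J"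
    using disj by (intro indep_sets_collect_sigma) (auto simp: Int_stable_def)
  moreover have "\<forall>j\<in>J. E j \<in> sigma_sets (space M) (\<Union>x\<in>B j. {?A x})"
    using E by (simp add: sets_relocation_sigma UNION_singleton_eq_range)
  ultimately show ?thesis
    using J by (intro indep_setsD) auto
qed

lemma relocation_sigma_subset_events:
  assumes "B \<subseteq> {2::nat..} \<times> {1..n}"
  shows "sets (relocation_sigma B) \<subseteq> events"
  unfolding sets_relocation_sigma
proof (rule sets.sigma_sets_subset)
  show "(\<lambda>(k, i). {\<omega> \<in> space M. R k i \<omega>}) ` B \<subseteq> events"
    using indep_relocations assms unfolding indep_events_def by blast
qed

lemma prob_Int_relocation_sigma:
  assumes "B \<subseteq> {2::nat..} \<times> {1..n}" "C \<subseteq> {2..} \<times> {1..n}" "B \<inter> C = {}"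
    and "E \<in> sets (relocation_sigma B)" "F \<in> sets (relocation_sigma C)"
  shows "prob (E \<inter> F) = prob E * prob F"
  using prob_INT_relocation_sigma[of "UNIV :: bool set" "\<lambda>b. if b then B else C"
      "\<lambda>b. if b then E else F"] assms
  by (auto simp: UNIV_bool disjoint_family_on_def Int_commute mult.commute)

lemma pred_relocation:
  "(k, i) \<in> B \<Longrightarrow> Measurable.pred (relocation_sigma B) (R k i)"
  unfolding pred_def by (auto simp: sets_relocation_sigma intro!: sigma_sets.Basic)

text \<open>Boarding at time 1 is deterministic, so only relocations at times from 2 on
  enter.\<close>

lemma measurable_last_move:
  assumes "\<And>s. 2 \<le> s \<Longrightarrow> k < s \<Longrightarrow> s \<le> l \<Longrightarrow> (s, i) \<in> B"
  shows "last_move R k i l \<in> measurable (relocation_sigma B) (count_space UNIV)"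
  using assms
proof (induction l)
  case 0
  have "last_move R k i 0 = (\<lambda>_. 0)" by (rule ext) simp
  then show ?case by simp
next
  case (Suc l)
  have [measurable]: "last_move R k i l \<in> measurable (relocation_sigma B) (count_space UNIV)"
    using Suc by auto
  have [measurable]: "Measurable.pred (relocation_sigma B) (R (Suc l) i)" if "k < Suc l" "l \<noteq> 0"
    using that Suc.prems by (intro pred_relocation) auto
  show ?case
  proof (cases "k < Suc l \<and> l \<noteq> 0")
    case True
    then have "last_move R k i (Suc l) = (\<lambda>\<omega>. if R (Suc l) i \<omega> then Suc l else last_move R k i l \<omega>)"
      by auto
    then show ?thesis using True by simp
  next
    case False
    then have "last_move R k i (Suc l) = (\<lambda>\<omega>. if Suc l \<le> k then 0 else Suc l)"
      by auto
    then show ?thesis by simp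
  qed
qed

lemma last_move_event:
  assumes "i \<in> {1..n}"
  shows "{\<omega> \<in> space M. last_move R k i l \<omega> = s} \<in> sets (relocation_sigma (({2..} \<inter> {k<..l}) \<times> {i}))"
proof -
  have [measurable]: "last_move R k i l \<in> measurable (relocation_sigma (({2..} \<inter> {k<..l}) \<times> {i})) (count_space UNIV)"
    by (rule measurable_last_move) auto
  have "{\<omega> \<in> space (relocation_sigma (({2..} \<inter> {k<..l}) \<times> {i})). last_move R k i l \<omega> = s}
      \<in> sets (relocation_sigma (({2..} \<inter> {k<..l}) \<times> {i}))"
    by measurable
  then show ?thesis by simp
qed

lemma distinct_movers_event:
  "{\<omega> \<in> space M. distinct_movers n R k l \<omega>} \<in> sets (relocation_sigma (({2..} \<inter> {k<..l}) \<times> {1..n}))"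
proof -
  let ?S = "relocation_sigma (({2..} \<inter> {k<..l}) \<times> {1..n})"
  \<comment> \<open>Injectivity on the movers becomes a finite conjunction over pairs, with the
    equality of two last moves split over its countably many values \<open>s\<close>.\<close>
  have inj_iff: "(\<forall>i\<in>I. \<forall>j\<in>I - {i}. \<not> (\<exists>s. s \<noteq> 0 \<and> f i = s \<and> f j = s)) \<longleftrightarrow>
      inj_on f {i \<in> I. f i \<noteq> 0}" for f :: "nat \<Rightarrow> nat" and I
  proof
    assume L: "\<forall>i\<in>I. \<forall>j\<in>I - {i}. \<not> (\<exists>s. s \<noteq> 0 \<and> f i = s \<and> f j = s)"
    show "inj_on f {i \<in> I. f i \<noteq> 0}"
    proof (rule inj_onI, rule ccontr)
      fix i j assume "i \<in> {i \<in> I. f i \<noteq> 0}" "j \<in> {i \<in> I. f i \<noteq> 0}" "f i = f j" "i \<noteq> j"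
      then show False using L[THEN bspec, of i, THEN bspec, of j] by auto
    qed
  qed (auto simp: inj_on_def)
  have "{\<omega> \<in> space ?S. \<not> (\<exists>s. s \<noteq> 0 \<and> last_move R k i l \<omega> = s \<and> last_move R k j l \<omega> = s)} \<in> sets ?S"
    if "i \<in> {1..n}" "j \<in> {1..n} - {i}" for i j
  proof -
    have [measurable]: "last_move R k i l \<in> measurable ?S (count_space UNIV)"
       "last_move R k j l \<in> measurable ?S (count_space UNIV)"
      using that by (auto intro!: measurable_last_move)
    show ?thesis by measurable
  qed
  then have "{\<omega> \<in> space ?S. \<forall>i\<in>{1..n}. \<forall>j\<in>{1..n} - {i}.
      \<not> (\<exists>s. s \<noteq> 0 \<and> last_move R k i l \<omega> = s \<and> last_move R k j l \<omega> = s)} \<in> sets ?S"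
    by (intro sets.sets_Collect_finite_All) auto
  also have "{\<omega> \<in> space ?S. \<forall>i\<in>{1..n}. \<forall>j\<in>{1..n} - {i}.
      \<not> (\<exists>s. s \<noteq> 0 \<and> last_move R k i l \<omega> = s \<and> last_move R k j l \<omega> = s)} =
      {\<omega> \<in> space M. distinct_movers n R k l \<omega>}"
    unfolding space_relocation_sigma distinct_movers_def by (simp only: inj_iff)
  finally show ?thesis .
qed

text \<open>A passenger stays at time \<open>j\<close> with probability \<open>(j - 1) / j\<close>,
  and these factors telescope: not moving in \<open>(k, l]\<close> has probability
  \<open>k / l\<close>, and moving at \<open>s\<close> and never again has
  \<open>(1 / s) * (s / l) = 1 / l\<close>.\<close>

lemma prob_last_move:
  assumes i: "i \<in> {1..n}" and "k \<le> l" "1 \<le> l" "s = 0 \<or> s \<in> {k<..l}"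
  shows "prob {\<omega> \<in> space M. last_move R k i l \<omega> = s} = (if s = 0 then real k else 1) / real l"
  using assms(2-4)
proof (induction l arbitrary: s)
  case (Suc l)
  let ?E = "\<lambda>l s. {\<omega> \<in> space M. last_move R k i l \<omega> = s}"
  consider "k = Suc l" | "k \<le> l" "l = 0" | "k \<le> l" "l \<noteq> 0" "s = Suc l" | "k \<le> l" "l \<noteq> 0" "s \<noteq> Suc l"
    using Suc.prems by linarith
  then show ?case
  proof cases
    case 1
    then show ?thesis using Suc.prems by (auto simp: prob_space)
  next
    case 2
    \<comment> \<open>Here \<open>k = 0\<close> and the current time is 1. Boarding is certain, in
      agreement with the values 0 / 1 and 1 / 1.\<close>
    then show ?thesis using Suc.prems by (auto simp: prob_space)
  next
    case 3
    have "last_move R k i l \<omega> \<noteq> Suc l" for \<omega>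
      using last_move_cases[of R k i l \<omega>] by auto
    then have "?E (Suc l) s = {\<omega> \<in> space M. R (Suc l) i \<omega>}"
      using 3 by auto
    then show ?thesis using prob_relocation[of "Suc l" i] i 3 by simp
  next
    case 4
    have R: "{\<omega> \<in> space M. R (Suc l) i \<omega>} \<in> sets (relocation_sigma {(Suc l, i)})"
      using pred_relocation[of "Suc l" i "{(Suc l, i)}"] by (simp add: pred_def)
    then have R': "{\<omega> \<in> space M. R (Suc l) i \<omega>} \<in> events"
      using relocation_sigma_subset_events[of "{(Suc l, i)}"] 4 i by auto
    have "?E (Suc l) s = (space M - {\<omega> \<in> space M. R (Suc l) i \<omega>}) \<inter> ?E l s"
      using 4 by auto
    also have "prob \<dots> = prob (space M - {\<omega> \<in> space M. R (Suc l) i \<omega>}) * prob (?E l s)"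
      using 4 i sets.compl_sets[OF R] last_move_event[OF i, of k l s]
      by (intro prob_Int_relocation_sigma[of "{(Suc l, i)}" "({2..} \<inter> {k<..l}) \<times> {i}"]) auto
    also have "prob (?E l s) = (if s = 0 then real k else 1) / real l"
      using 4 Suc.prems by (intro Suc.IH) auto
    also have "prob (space M - {\<omega> \<in> space M. R (Suc l) i \<omega>}) = 1 - 1 / real (Suc l)"
      using prob_compl[OF R'] prob_relocation[of "Suc l" i] i 4 by simp
    also have "1 - 1 / real (Suc l) = real l / real (Suc l)"
      by (simp add: field_simps)
    finally show ?thesis using 4 by (simp del: last_move.simps)
  qed
qed simp

text \<open>The event is a disjoint union over the possible vectors \<open>f\<close> of last moves,
  with 0 for a passenger who stays. Passengers are independent, so each vector has a product weight
  and the sum is one over partial injections.\<close>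

lemma prob_distinct_movers:
  assumes "k < l"
  shows "prob {\<omega> \<in> space M. distinct_movers n R k l \<omega>} = distinct_movers_prob n k l"
proof -
  let ?S = "{k<..l}" and ?I = "{1..n}"
  let ?F = "{f \<in> ?I \<rightarrow>\<^sub>E insert 0 ?S. inj_on f {i \<in> ?I. f i \<noteq> 0}}"
  let ?E = "\<lambda>f. \<Inter>i\<in>?I. {\<omega> \<in> space M. last_move R k i l \<omega> = f i}"
  have I: "finite ?I" "?I \<noteq> {}" using n_pos by auto
  have F: "finite ?F"
    by (intro finite_subset[OF _ finite_PiE[of ?I "\<lambda>_. insert 0 ?S"]]) auto
  have ev: "{\<omega> \<in> space M. last_move R k i l \<omega> = s} \<in> events" if "i \<in> ?I" for i s
  proof (rule subsetD[OF relocation_sigma_subset_events last_move_event[OF that]])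
    show "({2..} \<inter> {k<..l}) \<times> {i} \<subseteq> {2..} \<times> {1..n}" using that by auto
  qed
  have eq: "{\<omega> \<in> space M. distinct_movers n R k l \<omega>} = (\<Union>f\<in>?F. ?E f)"
  proof (intro equalityI subsetI)
    fix \<omega> assume \<omega>: "\<omega> \<in> {\<omega> \<in> space M. distinct_movers n R k l \<omega>}"
    let ?f = "\<lambda>i\<in>?I. last_move R k i l \<omega>"
    have "?f \<in> ?I \<rightarrow>\<^sub>E insert 0 ?S"
    proof (rule restrict_PiE_iff[THEN iffD2], rule ballI)
      show "last_move R k i l \<omega> \<in> insert 0 ?S" for i
        using last_move_cases[of R k i l \<omega>] by (simp only: insert_iff greaterThanAtMost_iff)
    qed
    moreover have "inj_on ?f {i \<in> ?I. ?f i \<noteq> 0}"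
      using \<omega> by (auto simp: distinct_movers_def inj_on_def)
    ultimately have "?f \<in> ?F" by blast
    moreover have "\<omega> \<in> ?E ?f" using \<omega> I by auto
    ultimately show "\<omega> \<in> (\<Union>f\<in>?F. ?E f)" by blast
  next
    fix \<omega> assume "\<omega> \<in> (\<Union>f\<in>?F. ?E f)"
    then obtain f where f: "inj_on f {i \<in> ?I. f i \<noteq> 0}" "\<omega> \<in> ?E f" by blast
    then have "\<omega> \<in> space M" "\<And>i. i \<in> ?I \<Longrightarrow> last_move R k i l \<omega> = f i" using I by auto
    then show "\<omega> \<in> {\<omega> \<in> space M. distinct_movers n R k l \<omega>}"
      using f(1) by (auto simp: distinct_movers_def inj_on_def)
  qed
  have "prob {\<omega> \<in> space M. distinct_movers n R k l \<omega>} = (\<Sum>f\<in>?F. prob (?E f))"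
    unfolding eq
  proof (rule finite_measure_finite_Union[OF F])
    show "?E ` ?F \<subseteq> events"
      using I ev by (auto intro!: sets.finite_INT)
    show "disjoint_family_on ?E ?F"
      unfolding disjoint_family_on_def
    proof (intro ballI impI)
      fix f g assume fg: "f \<in> ?F" "g \<in> ?F" "f \<noteq> g"
      then obtain i where "i \<in> ?I" "f i \<noteq> g i"
        using PiE_ext[of f ?I "\<lambda>_. insert 0 ?S" g] by blast
      then show "?E f \<inter> ?E g = {}" by force
    qed
  qed
  also have "\<dots> = (\<Sum>f\<in>?F. \<Prod>i\<in>?I. if f i = 0 then real k / real l else 1 / real l)"
  proof (rule sum.cong[OF refl])
    fix f assume f: "f \<in> ?F"
    have "prob (?E f) = (\<Prod>i\<in>?I. prob {\<omega> \<in> space M. last_move R k i l \<omega> = f i})"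
    proof (rule prob_INT_relocation_sigma[where B = "\<lambda>i. ({2..} \<inter> {k<..l}) \<times> {i}", OF I])
      show "({2..} \<inter> {k<..l}) \<times> {i} \<subseteq> {2..} \<times> {1..n}" if "i \<in> ?I" for i
        using that by auto
      show "disjoint_family_on (\<lambda>i. ({2..} \<inter> {k<..l}) \<times> {i}) ?I"
        by (auto simp: disjoint_family_on_def)
    qed (rule last_move_event)
    also have "\<dots> = (\<Prod>i\<in>?I. if f i = 0 then real k / real l else 1 / real l)"
    proof (rule prod.cong[OF refl])
      fix i assume "i \<in> ?I"
      then show "prob {\<omega> \<in> space M. last_move R k i l \<omega> = f i} =
          (if f i = 0 then real k / real l else 1 / real l)"
        using f assms by (subst prob_last_move) (auto simp: PiE_def Pi_def)
    qed
    finally show "prob (?E f) = (\<Prod>i\<in>?I. if f i = 0 then real k / real l else 1 / real l)" .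
  qed
  also have "\<dots> = (\<Sum>w\<le>n. real (n choose w) *
      ((\<Prod>i<w. real (l - k - i)) * (1 / real l) ^ w * (real k / real l) ^ (n - w)))"
    using sum_prod_partial_injections[of ?I ?S "real k / real l" "1 / real l"] I by simp
  also have "\<dots> = distinct_movers_prob n k l"
    unfolding distinct_movers_prob_def
  proof (rule sum.cong[OF refl])
    fix w assume "w \<in> {..n}"
    let ?m = "l - k"
    have m: "?m > 0" using assms by simp
    have "(\<Prod>i<w. real (?m - i)) = (\<Prod>i<w. real ?m * (1 - real i / real ?m))"
    proof (cases "w \<le> ?m")
      case True
      then show ?thesis using m by (intro prod.cong) (auto simp: field_simps of_nat_diff)
    next
      \<comment> \<open>For \<open>w > l - k\<close> both products contain the zero factor
        \<open>i = l - k\<close>, so truncated subtraction does no harm.\<close>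
      case False
      then have w: "?m \<in> {..<w}" by auto
      have "(\<Prod>i<w. real (?m - i)) = 0"
        by (rule prod_zero[OF finite_lessThan bexI[OF _ w]]) simp
      moreover have "(\<Prod>i<w. real ?m * (1 - real i / real ?m)) = 0"
        by (rule prod_zero[OF finite_lessThan bexI[OF _ w]]) (use m in simp)
      ultimately show ?thesis by (simp only:)
    qed
    also have "\<dots> = real ?m ^ w * (\<Prod>i<w. 1 - real i / real ?m)"
      by (simp add: prod.distrib)
    finally have 1: "(\<Prod>i<w. real (?m - i)) = real ?m ^ w * (\<Prod>i<w. 1 - real i / real ?m)" .
    \<comment> \<open>The probability of staying is the complement of the Bernstein
      argument.\<close>
    have 2: "1 - real ?m / real l = real k / real l"
      using assms by (simp add: field_simps of_nat_diff)
    show "real (n choose w) * ((\<Prod>i<w. real (?m - i)) * (1 / real l) ^ w * (real k / real l) ^ (n - w)) =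
        (\<Prod>i<w. 1 - real i / real ?m) * Bernstein n w (real ?m / real l)"
      unfolding 1 Bernstein_def 2 by (simp add: power_divide)
  qed
  finally show ?thesis .
qed

text \<open>Places detachment at earlier times in the past up to \<open>k\<close>, which is
  independent of the moves after \<open>k\<close>.\<close>

lemma detached_event:
  assumes "1 \<le> l" "l \<le> k"
  shows "{\<omega> \<in> space M. detached n R l \<omega>} \<in> sets (relocation_sigma ({2..k} \<times> {1..n}))"
proof -
  have "sets (relocation_sigma (({2..} \<inter> {0<..l}) \<times> {1..n})) \<subseteq> sets (relocation_sigma ({2..k} \<times> {1..n}))"
    unfolding sets_relocation_sigma using assms by (intro sigma_sets_mono') auto
  then show ?thesis
    using distinct_movers_event[of 0 l] assms by (auto simp: detached_first)
qed

text \<open>\<open>k\<close> is the latest of the earlier bus times, or 0 if there are none. Given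
  detachment there, detachment at \<open>\<kappa> b\<close> is an event about moves after
  \<open>k\<close> only, so the probability factorises.\<close>

lemma prob_detached_insert:
  assumes U: "finite U" "\<And>t. t \<in> U \<Longrightarrow> 1 \<le> \<kappa> t \<and> \<kappa> t \<le> k" "U \<noteq> {} \<Longrightarrow> \<exists>t\<in>U. \<kappa> t = k"
    and kl: "k < \<kappa> b" and k0: "U = {} \<Longrightarrow> k = 0"
  shows "prob {\<omega> \<in> space M. \<forall>t\<in>insert b U. detached n R (\<kappa> t) \<omega>} =
    prob {\<omega> \<in> space M. \<forall>t\<in>U. detached n R (\<kappa> t) \<omega>} * distinct_movers_prob n k (\<kappa> b)"
proof -
  let ?S = "relocation_sigma ({2..k} \<times> {1..n})"
  let ?E = "{\<omega> \<in> space M. \<forall>t\<in>U. detached n R (\<kappa> t) \<omega>}"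
  have "{\<omega> \<in> space ?S. \<forall>t\<in>U. detached n R (\<kappa> t) \<omega>} \<in> sets ?S"
  proof (intro sets.sets_Collect_finite_All)
    show "{\<omega> \<in> space ?S. detached n R (\<kappa> t) \<omega>} \<in> sets ?S" if "t \<in> U" for t
      using detached_event[of "\<kappa> t" k] U(2)[OF that] by simp
  qed fact
  then have E: "?E \<in> sets ?S" by simp
  have "detached n R (\<kappa> b) \<omega> \<longleftrightarrow> distinct_movers n R k (\<kappa> b) \<omega>"
    if "\<forall>t\<in>U. detached n R (\<kappa> t) \<omega>" for \<omega>
  proof (cases "U = {}")
    case True
    then show ?thesis using k0 kl by (simp add: detached_first)
  next
    case False
    then obtain t where "t \<in> U" "\<kappa> t = k" using U(3) by auto
    then show ?thesis using that U(2)[of t] kl by (intro detached_step) auto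
  qed
  then have "{\<omega> \<in> space M. \<forall>t\<in>insert b U. detached n R (\<kappa> t) \<omega>} =
      ?E \<inter> {\<omega> \<in> space M. distinct_movers n R k (\<kappa> b) \<omega>}"
    by auto
  also have "prob \<dots> = prob ?E * prob {\<omega> \<in> space M. distinct_movers n R k (\<kappa> b) \<omega>}"
    by (rule prob_Int_relocation_sigma[OF _ _ _ E distinct_movers_event]) auto
  finally show ?thesis using prob_distinct_movers[OF kl] by simp
qed

end

subsection \<open>The limit process\<close>

definition unit_uniform :: "real measure" where
  "unit_uniform = uniform_measure lborel {0..1}"

definition pair_law :: "(real \<times> real) measure" where
  "pair_law = unit_uniform \<Otimes>\<^sub>M unit_uniform"

text \<open>
  The absolute value changes nothing almost surely, but makes every interval start after \<open>-1\<close>: this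
  is how \<open>hit_prob_insert\<close> treats an empty set of earlier times.
\<close>

definition sharing :: "real \<Rightarrow> real \<times> real \<Rightarrow> bool" where
  "sharing t x \<longleftrightarrow> \<bar>snd x / fst x\<bar> \<le> t \<and> t < 1 / fst x"

lemma prob_space_unit_uniform: "prob_space unit_uniform"
  unfolding unit_uniform_def by (rule prob_space_uniform_measure) auto

lemma sets_unit_uniform [simp, measurable_cong]: "sets unit_uniform = sets borel"
  by (simp add: unit_uniform_def)

lemma space_unit_uniform [simp]: "space unit_uniform = UNIV"
  by (simp add: unit_uniform_def)

lemma emeasure_unit_uniform:
  "B \<in> sets borel \<Longrightarrow> emeasure unit_uniform B = emeasure lborel ({0..1} \<inter> B)"
  by (simp add: unit_uniform_def divide_ennreal_def)

lemma nn_integral_unit_uniform: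
  "f \<in> borel_measurable borel \<Longrightarrow>
    (\<integral>\<^sup>+x. f x \<partial>unit_uniform) = (\<integral>\<^sup>+x. f x * indicator {0..1} x \<partial>lborel)"
  by (simp add: unit_uniform_def nn_integral_uniform_measure divide_ennreal_def)

lemma prob_space_pair_law: "prob_space pair_law"
proof -
  interpret U: prob_space unit_uniform by (rule prob_space_unit_uniform)
  interpret pair_prob_space unit_uniform unit_uniform ..
  show ?thesis unfolding pair_law_def by (rule prob_space_axioms)
qed

lemma space_pair_law [simp]: "space pair_law = UNIV"
  by (simp add: pair_law_def space_pair_measure)

lemma pred_sharing [measurable]: "Measurable.pred pair_law (sharing t)"
  unfolding sharing_def[abs_def] pair_law_def by measurable

text \<open>For \<open>U = u\<close> below \<open>1 / b\<close>, the admissible values of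
  \<open>V\<close> form an interval of length \<open>(b - max a 0) * u\<close>; integration over
  \<open>u\<close> from 0 to \<open>1 / b\<close> gives the claim. The maximum appears because
  births are nonnegative.\<close>

lemma measure_sharing_born_after:
  assumes "a < b" "1 \<le> b"
  shows "measure pair_law {x. a < \<bar>snd x / fst x\<bar> \<and> sharing b x} = (b - max a 0) / (2 * b\<^sup>2)"
proof -
  interpret U: prob_space unit_uniform by (rule prob_space_unit_uniform)
  let ?E = "{x. a < \<bar>snd x / fst x\<bar> \<and> sharing b x}"
  let ?c = "b - max a 0"
  define F where "F = (\<lambda>u :: real. ?c * u\<^sup>2 / 2)"
  have c: "?c > 0" using assms by auto
  have "{x \<in> space (unit_uniform \<Otimes>\<^sub>M unit_uniform). a < \<bar>snd x / fst x\<bar> \<and> sharing b x}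
      \<in> sets (unit_uniform \<Otimes>\<^sub>M unit_uniform)"
    unfolding sharing_def by measurable
  then have E: "?E \<in> sets (unit_uniform \<Otimes>\<^sub>M unit_uniform)" by (simp add: space_pair_measure)
  have m: "(\<lambda>u. emeasure unit_uniform (Pair u -` ?E)) \<in> borel_measurable borel"
    using U.measurable_emeasure_Pair[OF E] by simp
  \<comment> \<open>At \<open>u = 1 / b\<close> the interval ends exactly at \<open>b\<close>, so
    the left side is 0, while the closed indicator suited to the fundamental theorem of calculus is
    1. This single point is a null set.\<close>
  have pw: "emeasure unit_uniform (Pair u -` ?E) * indicator {0..1} u =
      ennreal (?c * u) * indicator {0..1 / b} u" if ne: "u \<noteq> 1 / b" for u
  proof (cases "0 < u \<and> u < 1 / b")
    case True
    then have u: "0 < u" "u * b < 1" using assms by (auto simp: field_simps)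
    then have u1: "u \<le> 1" using mult_left_mono[OF assms(2), of u] by linarith
    have bu: "b < 1 / u" using u by (simp add: field_simps)
    \<comment> \<open>The constraint \<open>v \<le> 1\<close> is automatic, as
      \<open>b * u < 1\<close>.\<close>
    have mem: "v \<in> {0..1} \<inter> Pair u -` ?E \<longleftrightarrow> 0 \<le> v \<and> a * u < v \<and> v \<le> b * u" for v
    proof (cases "0 \<le> v")
      case v: True
      have "\<bar>v / u\<bar> = v / u" using u v by simp
      then have "v \<in> {0..1} \<inter> Pair u -` ?E \<longleftrightarrow> v \<le> 1 \<and> a < v / u \<and> v / u \<le> b"
        using v bu by (auto simp: sharing_def)
      also have "\<dots> \<longleftrightarrow> 0 \<le> v \<and> a * u < v \<and> v \<le> b * u"
        using u v by (auto simp: pos_less_divide_eq pos_divide_le_eq mult.commute[of b])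
      finally show ?thesis .
    qed auto
    have "{0..1} \<inter> Pair u -` ?E = (if a < 0 then {0..b * u} else {a * u<..b * u})"
    proof (cases "a < 0")
      case True
      then have "a * u < 0" using u by (simp add: mult_neg_pos)
      then have "v \<in> {0..1} \<inter> Pair u -` ?E \<longleftrightarrow> v \<in> {0..b * u}" for v
        unfolding mem atLeastAtMost_iff by linarith
      then show ?thesis using True by (intro set_eqI) (simp only: if_True)
    next
      case False
      then have "0 \<le> a * u" using u by simp
      then have "v \<in> {0..1} \<inter> Pair u -` ?E \<longleftrightarrow> v \<in> {a * u<..b * u}" for v
        unfolding mem greaterThanAtMost_iff by linarith
      then show ?thesis using False by (intro set_eqI) (simp only: if_False)
    qed
    moreover have "Pair u -` ?E \<in> sets borel"
      using sets_Pair1[OF E, of u] by simp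
    ultimately have "emeasure unit_uniform (Pair u -` ?E) =
        emeasure lborel (if a < 0 then {0..b * u} else {a * u<..b * u})"
      by (simp only: emeasure_unit_uniform)
    also have "\<dots> = ennreal (?c * u)"
    proof (cases "a < 0")
      case True
      have "0 \<le> b * u" using u assms by simp
      then show ?thesis using True by simp
    next
      case False
      have "a * u \<le> b * u" using u assms by simp
      then show ?thesis using False by (simp add: left_diff_distrib)
    qed
    finally have "emeasure unit_uniform (Pair u -` ?E) = ennreal (?c * u)" .
    moreover have "indicator {0..1} u = (1 :: ennreal)" "indicator {0..1 / b} u = (1 :: ennreal)"
      using True u1 by (auto simp: indicator_def)
    ultimately show ?thesis by (simp only: mult_1_right)
  next
    case False
    consider "u < 0" | "u = 0" | "u > 1 / b"
      using ne False by linarith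
    then show ?thesis
    proof cases
      case 1
      then have "indicator {0..1} u = (0 :: ennreal)" "indicator {0..1 / b} u = (0 :: ennreal)"
        by (auto simp: indicator_def)
      then show ?thesis by (simp only: mult_zero_right)
    next
      case 2
      \<comment> \<open>Division by zero gives 0, so the interval would have to end at 0, before
        \<open>b\<close>.\<close>
      then have "Pair u -` ?E = {}" using assms by (auto simp: sharing_def)
      moreover have "ennreal (?c * u) = 0" using 2 by simp
      ultimately show ?thesis by (simp only: emeasure_empty mult_zero_left)
    next
      case 3
      have "0 < 1 / b" using assms by simp
      with 3 have "0 < u" by linarith
      then have "1 / u < b" using 3 assms by (simp add: field_simps)
      then have "Pair u -` ?E = {}" by (auto simp: sharing_def)
      moreover have "indicator {0..1 / b} u = (0 :: ennreal)"
        using 3 by (auto simp: indicator_def)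
      ultimately show ?thesis
        by (simp only: emeasure_empty mult_zero_left mult_zero_right)
    qed
  qed
  have "emeasure pair_law ?E = (\<integral>\<^sup>+u. emeasure unit_uniform (Pair u -` ?E) \<partial>unit_uniform)"
    unfolding pair_law_def by (rule U.emeasure_pair_measure_alt[OF E])
  also have "\<dots> = (\<integral>\<^sup>+u. emeasure unit_uniform (Pair u -` ?E) * indicator {0..1} u \<partial>lborel)"
    by (rule nn_integral_unit_uniform[OF m])
  also have "\<dots> = (\<integral>\<^sup>+u. ennreal (?c * u) * indicator {0..1 / b} u \<partial>lborel)"
  proof (rule nn_integral_cong_AE)
    show "AE u in lborel. emeasure unit_uniform (Pair u -` ?E) * indicator {0..1} u =
        ennreal (?c * u) * indicator {0..1 / b} u"
      using AE_lborel_singleton[of "1 / b"] by (rule eventually_mono) (rule pw)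
  qed
  also have "\<dots> = ennreal (F (1 / b) - F 0)"
    using assms c unfolding F_def
    by (intro nn_integral_FTC_Icc)
      (auto intro!: derivative_eq_intros mult_left_mono simp: field_simps)
  also have "F (1 / b) - F 0 = ?c / (2 * b\<^sup>2)"
    by (simp add: F_def power_divide)
  finally show ?thesis
    using c by (simp add: measure_def)
qed

text \<open>For a Poisson(1) number of intervals this is also the mean number of intervals that meet
  \<open>U\<close>, hence the exponent of the probability that none does.\<close>

definition hit_prob :: "real set \<Rightarrow> real" where
  "hit_prob U = measure pair_law {x. \<exists>t\<in>U. sharing t x}"

lemma hit_prob_empty [simp]: "hit_prob {} = 0"
  by (simp add: hit_prob_def)

text \<open>An interval that contains \<open>b\<close> but no point of \<open>U\<close> must start
  after the largest point \<open>a\<close>, and conversely such a start misses all of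
  \<open>U\<close>. The increment is exactly the exponent in
  \<open>distinct_movers_prob_tendsto\<close>, which is why the two processes match.\<close>

lemma hit_prob_insert:
  assumes U: "finite U" "\<And>t. t \<in> U \<Longrightarrow> 1 \<le> t \<and> t \<le> a" "U \<noteq> {} \<Longrightarrow> a \<in> U"
    and a: "U = {} \<Longrightarrow> a = 0" and b: "a < b" "1 \<le> b"
  shows "hit_prob (insert b U) = hit_prob U + (b - a) / (2 * b\<^sup>2)"
proof -
  interpret prob_space pair_law by (rule prob_space_pair_law)
  \<comment> \<open>With no earlier times every birth must count, including one at exactly 0, so the
    strict lower bound is put at -1.\<close>
  define a' where "a' = (if U = {} then -1 else a)"
  have a': "max a' 0 = a"
  proof (cases "U = {}")
    case False
    then show ?thesis using U(2)[of a] U(3) by (auto simp: a'_def)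
  qed (use a in \<open>simp add: a'_def\<close>)
  have "a' < b" using b by (auto simp: a'_def)
  let ?H = "{x. \<exists>t\<in>U. sharing t x}" and ?B = "{x. a' < \<bar>snd x / fst x\<bar> \<and> sharing b x}"
  have "\<bar>snd x / fst x\<bar> > a'" if "sharing b x" "\<not> (\<exists>t\<in>U. sharing t x)" for x
  proof (cases "U = {}")
    case False
    then have "\<not> sharing a x" using U(3) that by auto
    then show ?thesis using False that b by (auto simp: sharing_def a'_def)
  next
    case True
    then have "a' = -1" by (simp add: a'_def)
    then show ?thesis using abs_ge_zero[of "snd x / fst x"] by linarith
  qed
  then have "{x. \<exists>t\<in>insert b U. sharing t x} = ?H \<union> ?B"
    by blast
  moreover have "?H \<inter> ?B = {}"
  proof -
    have "\<bar>snd x / fst x\<bar> \<le> a'" if "t \<in> U" "sharing t x" for t x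
      using that U(2)[OF that(1)] by (auto simp: sharing_def a'_def)
    then show ?thesis by fastforce
  qed
  moreover have "{x \<in> space pair_law. \<exists>t\<in>U. sharing t x} \<in> events"
    using U(1) by measurable
  then have "?H \<in> events" by (simp only: space_pair_law UNIV_I simp_thms)
  moreover have "{x \<in> space pair_law. a' < \<bar>snd x / fst x\<bar> \<and> sharing b x} \<in> events"
    unfolding sharing_def pair_law_def by measurable
  then have "?B \<in> events" by (simp only: space_pair_law UNIV_I simp_thms)
  ultimately show ?thesis
    using measure_sharing_born_after[OF \<open>a' < b\<close> b(2)] a'
    by (simp add: hit_prob_def finite_measure_Union)
qed

text \<open>A Poisson point process with intensity \<open>pair_law\<close>, encoded by its number of
  points and an i.i.d. sequence whose first \<open>fst z\<close> terms are the points.\<close>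

definition shared_pairs_law :: "(nat \<times> (nat \<Rightarrow> real \<times> real)) measure" where
  "shared_pairs_law = measure_pmf (poisson_pmf 1) \<Otimes>\<^sub>M PiM UNIV (\<lambda>_. pair_law)"

definition no_sharing :: "real \<Rightarrow> nat \<times> (nat \<Rightarrow> real \<times> real) \<Rightarrow> real" where
  "no_sharing t z = (if \<exists>i<fst z. sharing t (snd z i) then 0 else 1)"

lemma prob_space_PiM_pair_law: "prob_space (PiM UNIV (\<lambda>_ :: nat. pair_law))"
  by (intro prob_space_PiM prob_space_pair_law)

lemma prob_space_shared_pairs_law: "prob_space shared_pairs_law"
proof -
  interpret Q: prob_space "PiM UNIV (\<lambda>_ :: nat. pair_law)" by (rule prob_space_PiM_pair_law)
  interpret KQ: pair_prob_space "measure_pmf (poisson_pmf 1)" "PiM UNIV (\<lambda>_ :: nat. pair_law)" ..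
  show ?thesis unfolding shared_pairs_law_def by (rule KQ.prob_space_axioms)
qed

lemma space_shared_pairs_law [simp]: "space shared_pairs_law = UNIV"
  by (simp add: shared_pairs_law_def space_pair_measure space_PiM)

lemma measurable_no_sharing: "no_sharing t \<in> borel_measurable shared_pairs_law"
proof -
  have "Measurable.pred shared_pairs_law (\<lambda>z. i < fst z \<and> sharing t (snd z i))" for i
    unfolding shared_pairs_law_def by measurable
  then have [measurable]: "Measurable.pred shared_pairs_law (\<lambda>z. \<exists>i. i < fst z \<and> sharing t (snd z i))"
    by measurable
  show ?thesis unfolding no_sharing_def[abs_def] by measurable
qed

text \<open>Each path is determined by finitely many comparisons of \<open>t\<close> with births and
  deaths, and each comparison is constant just before and just after any time. Intervals closed on
  the left and open on the right give right-continuity.\<close>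

lemma cadlag_no_sharing: "cadlag_on_ge1 (\<lambda>t. no_sharing t z)"
proof -
  have right: "\<forall>\<^sub>F s in at_right t. (c \<le> s \<longleftrightarrow> c \<le> t)" for c t :: real
  proof (cases "c \<le> t")
    case True
    then show ?thesis using eventually_at_right_less[of t] by (auto elim!: eventually_mono)
  next
    case False
    then have "\<forall>\<^sub>F s in at_right t. s < c"
      by (intro order_tendstoD(2)[OF tendsto_ident_at]) auto
    then show ?thesis using False by (auto elim!: eventually_mono)
  qed
  have left: "\<forall>\<^sub>F s in at_left t. (c \<le> s \<longleftrightarrow> c < t)" for c t :: real
  proof (cases "c < t")
    case True
    then have "\<forall>\<^sub>F s in at_left t. c < s"
      by (intro order_tendstoD(1)[OF tendsto_ident_at]) auto
    then show ?thesis using True by (auto elim!: eventually_mono)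
  next
    case False
    have "\<forall>\<^sub>F s in at_left t. s < t"
      by (auto simp: eventually_at_filter)
    then show ?thesis using False by (auto elim!: eventually_mono)
  qed
  define birth death where "birth = (\<lambda>i. \<bar>snd (snd z i) / fst (snd z i)\<bar>)"
    and "death = (\<lambda>i. 1 / fst (snd z i))"
  have eq: "no_sharing t z = (if \<exists>i<fst z. birth i \<le> t \<and> \<not> death i \<le> t then 0 else 1)" for t
    by (simp add: no_sharing_def sharing_def birth_def death_def not_le)
  show ?thesis
    unfolding cadlag_on_ge1_def
  proof (intro conjI allI impI)
    fix t :: real
    have "\<forall>\<^sub>F s in at_right t. \<forall>i\<in>{..<fst z}. (birth i \<le> s \<longleftrightarrow> birth i \<le> t) \<and> (death i \<le> s \<longleftrightarrow> death i \<le> t)"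
      by (intro eventually_ball_finite ballI eventually_conj right) auto
    then have "\<forall>\<^sub>F s in at_right t. no_sharing s z = no_sharing t z"
      by eventually_elim (auto simp: eq)
    then show "((\<lambda>t. no_sharing t z) \<longlongrightarrow> no_sharing t z) (at_right t)"
      by (rule tendsto_eventually)
  next
    fix t :: real
    have "\<forall>\<^sub>F s in at_left t. \<forall>i\<in>{..<fst z}. (birth i \<le> s \<longleftrightarrow> birth i < t) \<and> (death i \<le> s \<longleftrightarrow> death i < t)"
      by (intro eventually_ball_finite ballI eventually_conj left) auto
    then have "\<forall>\<^sub>F s in at_left t. no_sharing s z =
        (if \<exists>i<fst z. birth i < t \<and> \<not> death i < t then 0 else 1)"
      by eventually_elim (auto simp: eq)
    then show "\<exists>l. ((\<lambda>t. no_sharing t z) \<longlongrightarrow> l) (at_left t)"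
      by (intro exI) (rule tendsto_eventually)
  qed
qed

text \<open>Given \<open>k\<close> intervals, all of them miss \<open>U\<close> with probability
  \<open>q ^ k\<close> by independence; the generating function of the Poisson(1) law at
  \<open>q\<close> is \<open>exp (q - 1)\<close>.\<close>

lemma measure_no_sharing:
  assumes "finite U"
  shows "measure shared_pairs_law {z. \<forall>t\<in>U. no_sharing t z = 1} = exp (- hit_prob U)"
proof -
  interpret D: prob_space pair_law by (rule prob_space_pair_law)
  let ?P = "PiM UNIV (\<lambda>_ :: nat. pair_law)"
  interpret PP: product_prob_space "\<lambda>_ :: nat. pair_law" UNIV
    by (rule product_prob_spaceI) (rule prob_space_pair_law)
  interpret P: prob_space ?P by (rule prob_space_PiM_pair_law)
  define q where "q = 1 - hit_prob U"
  define G where "G = {x. \<forall>t\<in>U. \<not> sharing t x}"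
  let ?E = "{z. \<forall>t\<in>U. no_sharing t z = 1}"
  have "{x \<in> space pair_law. \<forall>t\<in>U. \<not> sharing t x} \<in> D.events"
    using assms by measurable
  then have G: "G \<in> D.events" by (simp add: G_def)
  have "G = space pair_law - {x. \<exists>t\<in>U. sharing t x}" by (auto simp: G_def)
  moreover have "{x \<in> space pair_law. \<exists>t\<in>U. sharing t x} \<in> D.events"
    using assms by measurable
  ultimately have q: "measure pair_law G = q"
    using D.prob_compl[of "{x. \<exists>t\<in>U. sharing t x}"] by (simp add: q_def hit_prob_def)
  then have "0 \<le> q" by (metis measure_nonneg)
  have [measurable]: "no_sharing t \<in> borel_measurable shared_pairs_law" for t
    by (rule measurable_no_sharing)
  have "{z \<in> space shared_pairs_law. \<forall>t\<in>U. no_sharing t z = 1} \<in> sets shared_pairs_law"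
    using assms by (intro sets.sets_Collect_finite_All) measurable
  then have "?E \<in> sets shared_pairs_law"
    by simp
  note E = this[unfolded shared_pairs_law_def]
  have slice: "emeasure ?P (Pair k -` ?E) = ennreal (q ^ k)" for k
  proof -
    \<comment> \<open>With the number of intervals fixed, the event constrains only the first
      \<open>k\<close> coordinates and is a cylinder.\<close>
    have "Pair k -` ?E = prod_emb UNIV (\<lambda>_. pair_law) {..<k} (Pi\<^sub>E {..<k} (\<lambda>_. G))"
      by (auto simp: prod_emb_def no_sharing_def G_def PiE_def Pi_def split: if_splits)
    also have "emeasure ?P \<dots> = (\<Prod>i\<in>{..<k}. emeasure pair_law G)"
      using G by (intro PP.emeasure_PiM_emb) auto
    finally show ?thesis
      using \<open>0 \<le> q\<close> by (simp add: D.emeasure_eq_measure q ennreal_power)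
  qed
  have "(\<lambda>k. (q ^ k /\<^sub>R fact k) * exp (- 1)) sums (exp q * exp (- 1))"
    by (intro sums_mult2 exp_converges)
  then have sums: "(\<lambda>k. pmf (poisson_pmf 1) k * q ^ k) sums exp (- hit_prob U)"
    by (simp add: q_def exp_add[symmetric] field_simps)
  have "emeasure shared_pairs_law ?E = (\<integral>\<^sup>+k. ennreal (q ^ k) \<partial>measure_pmf (poisson_pmf 1))"
    unfolding shared_pairs_law_def
    by (subst sigma_finite_measure.emeasure_pair_measure_alt
        [OF prob_space_imp_sigma_finite[OF prob_space_PiM_pair_law] E]) (simp only: slice)
  also have "\<dots> = (\<Sum>k. ennreal (pmf (poisson_pmf 1) k * q ^ k))"
    using \<open>0 \<le> q\<close>
    by (simp only: nn_integral_measure_pmf nn_integral_count_space_nat ennreal_mult pmf_nonneg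
        zero_le_power)
  also have "\<dots> = ennreal (exp (- hit_prob U))"
    using \<open>0 \<le> q\<close> by (intro suminf_ennreal_eq sums) auto
  finally show ?thesis by (simp add: measure_def)
qed

text \<open>The limit has to live on functions from reals to reals; any injection serves.\<close>

definition encode :: "nat \<times> (nat \<Rightarrow> real \<times> real) \<Rightarrow> real \<Rightarrow> real" where
  "encode z x = (if x < 0 then real (fst z)
     else if x \<in> \<int> then fst (snd z (nat \<lfloor>x\<rfloor>)) else snd (snd z (nat \<lfloor>x\<rfloor>)))"

lemma inj_encode: "inj encode"
proof (rule injI)
  fix y z assume eq: "encode y = encode z"
  have "fst y = fst z"
    using fun_cong[OF eq, of "-1"] by (simp add: encode_def)
  moreover have "snd y i = snd z i" for i
  proof -
    \<comment> \<open>The points \<open>i\<close> and \<open>i + 1 / 2\<close> are where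
      \<open>encode\<close> reveals the two components of the \<open>i\<close>-th pair.\<close>
    have half: "real i + 1 / 2 \<notin> \<int>"
    proof
      assume "real i + 1 / 2 \<in> \<int>"
      then have "real_of_int \<lfloor>real i + 1 / 2\<rfloor> = real i + 1 / 2" by (simp add: of_int_floor)
      moreover have "\<lfloor>real i + 1 / 2\<rfloor> = int i" by (simp add: floor_eq_iff)
      ultimately show False by simp
    qed
    have "\<lfloor>real i + 1 / 2\<rfloor> = int i" by (simp add: floor_eq_iff)
    then have "snd (snd y i) = snd (snd z i)"
      using fun_cong[OF eq, of "real i + 1 / 2"] half by (simp add: encode_def)
    moreover have "fst (snd y i) = fst (snd z i)"
      using fun_cong[OF eq, of "real i"] by (simp add: encode_def)
    ultimately show ?thesis by (intro prod_eqI)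
  qed
  then have "snd y = snd z" by (rule ext)
  ultimately show "y = z" by (rule prod_eqI)
qed

subsection \<open>Convergence\<close>

lemma nat_floor_scaled_tendsto:
  assumes "0 \<le> t"
  shows "(\<lambda>n. real (nat \<lfloor>t * real n ^ 2\<rfloor>) / real n ^ 2) \<longlonglongrightarrow> t"
proof (rule tendsto_sandwich)
  have pos: "\<forall>\<^sub>F n :: nat in sequentially. n > 0" by (rule eventually_gt_at_top)
  have floor: "real (nat \<lfloor>t * real n ^ 2\<rfloor>) = of_int \<lfloor>t * real n ^ 2\<rfloor>" for n
    using assms by (simp add: of_nat_nat)
  show "\<forall>\<^sub>F n in sequentially. t - 1 / real n * (1 / real n) \<le> real (nat \<lfloor>t * real n ^ 2\<rfloor>) / real n ^ 2"
    using pos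
  proof eventually_elim
    case (elim n)
    have "t - 1 / real n * (1 / real n) = (t * real n ^ 2 - 1) / real n ^ 2"
      using elim by (simp add: field_simps power2_eq_square)
    also have "\<dots> \<le> real (nat \<lfloor>t * real n ^ 2\<rfloor>) / real n ^ 2"
      unfolding floor by (intro divide_right_mono) (linarith, simp)
    finally show ?case .
  qed
  show "\<forall>\<^sub>F n in sequentially. real (nat \<lfloor>t * real n ^ 2\<rfloor>) / real n ^ 2 \<le> t"
    using pos
  proof eventually_elim
    case (elim n)
    then show ?case unfolding floor by (simp add: divide_le_eq)
  qed
  have "(\<lambda>n. t - 1 / real n * (1 / real n)) \<longlonglongrightarrow> t - 0 * 0"
    by (intro tendsto_intros lim_1_over_n)
  then show "(\<lambda>n. t - 1 / real n * (1 / real n)) \<longlonglongrightarrow> t" by simp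
qed simp

text \<open>Times are added in increasing order. Each new time contributes one factor, whose
  limiting exponent is the increment of \<open>hit_prob\<close>.\<close>

lemma prob_detached_tendsto:
  fixes M :: "nat \<Rightarrow> 'a measure"
  assumes proc: "\<And>n. n \<ge> 1 \<Longrightarrow> detachment_process (M n) n (R n)"
    and "finite U" "U \<subseteq> {1..}"
  shows "(\<lambda>n. measure (M n) {\<omega> \<in> space (M n). \<forall>t\<in>U. detached n (R n) (nat \<lfloor>t * real n ^ 2\<rfloor>) \<omega>})
    \<longlonglongrightarrow> exp (- hit_prob U)"
  using assms(2,3)
proof (induction U rule: finite_linorder_max_induct)
  case empty
  have "\<forall>\<^sub>F n :: nat in sequentially. n \<ge> 1" by (rule eventually_ge_at_top)
  then have "\<forall>\<^sub>F n in sequentially. 1 = measure (M n) {\<omega> \<in> space (M n).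
      \<forall>t\<in>{}. detached n (R n) (nat \<lfloor>t * real n ^ 2\<rfloor>) \<omega>}"
  proof eventually_elim
    case (elim n)
    interpret detachment_process "M n" n "R n" using proc elim .
    show ?case by (simp add: prob_space)
  qed
  then show ?case
    by (intro Lim_transform_eventually[OF tendsto_const]) auto
next
  case (insert b U)
  define \<kappa> where "\<kappa> = (\<lambda>(n :: nat) t. nat \<lfloor>t * real n ^ 2\<rfloor>)"
  \<comment> \<open>The value 0 for empty \<open>U\<close> makes the preceding bus time 0, as
    \<open>prob_detached_insert\<close> requires for the first factor.\<close>
  define a where "a = (if U = {} then 0 else Max U)"
  have a: "1 \<le> t \<and> t \<le> a" if "t \<in> U" for t
    using that insert by (auto simp: a_def)
  have aU: "a \<in> U" if "U \<noteq> {}"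
    using that insert by (simp add: a_def)
  have b: "1 \<le> b" "0 \<le> a" "a < b"
  proof -
    show b1: "1 \<le> b" using insert.prems by simp
    show "0 \<le> a" "a < b"
      using insert.hyps(2) aU a[of a] b1 by (cases "U = {}"; force simp: a_def)+
  qed
  have lim: "(\<lambda>n. real (\<kappa> n a) / real n ^ 2) \<longlonglongrightarrow> a" "(\<lambda>n. real (\<kappa> n b) / real n ^ 2) \<longlonglongrightarrow> b"
    unfolding \<kappa>_def by (rule nat_floor_scaled_tendsto; use b in linarith)+
  define P where "P = (\<lambda>n U. measure (M n) {\<omega> \<in> space (M n). \<forall>t\<in>U. detached n (R n) (\<kappa> n t) \<omega>})"
  have "(\<lambda>n. P n U * distinct_movers_prob n (\<kappa> n a) (\<kappa> n b)) \<longlonglongrightarrow>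
      exp (- hit_prob U) * exp (- (b - a) / (2 * b\<^sup>2))"
    using insert b unfolding P_def \<kappa>_def
    by (intro tendsto_mult distinct_movers_prob_tendsto lim[unfolded \<kappa>_def]) auto
  also have "exp (- hit_prob U) * exp (- (b - a) / (2 * b\<^sup>2)) = exp (- hit_prob (insert b U))"
    using hit_prob_insert[of U a b] insert a aU b
    by (simp add: a_def exp_add[symmetric] minus_divide_left)
  finally have "(\<lambda>n. P n U * distinct_movers_prob n (\<kappa> n a) (\<kappa> n b)) \<longlonglongrightarrow> exp (- hit_prob (insert b U))" .
  moreover have "\<forall>\<^sub>F n in sequentially.
      P n U * distinct_movers_prob n (\<kappa> n a) (\<kappa> n b) = P n (insert b U)"
  proof -
    have "(\<lambda>n. real (\<kappa> n b) / real n ^ 2 - real (\<kappa> n a) / real n ^ 2) \<longlonglongrightarrow> b - a"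
      by (intro tendsto_intros lim)
    then have "\<forall>\<^sub>F n in sequentially. real (\<kappa> n b) / real n ^ 2 - real (\<kappa> n a) / real n ^ 2 > 0"
      by (rule order_tendstoD(1)) (use b in simp)
    then have "\<forall>\<^sub>F n in sequentially. \<kappa> n a < \<kappa> n b"
      by eventually_elim (auto simp: diff_divide_distrib[symmetric] zero_less_divide_iff)
    then show ?thesis
      using eventually_ge_at_top[of 1]
    proof eventually_elim
      case (elim n)
      interpret detachment_process "M n" n "R n" using proc elim(2) .
      have \<kappa>: "1 \<le> \<kappa> n t \<and> \<kappa> n t \<le> \<kappa> n a" if "t \<in> U" for t
      proof
        have "1 * 1 \<le> t * real n ^ 2"
          using a[OF that] elim(2) by (intro mult_mono) auto
        then show "1 \<le> \<kappa> n t" by (simp add: \<kappa>_def le_nat_iff le_floor_iff)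
        show "\<kappa> n t \<le> \<kappa> n a"
          using a[OF that] by (auto simp: \<kappa>_def intro!: nat_mono floor_mono mult_right_mono)
      qed
      have "\<exists>t\<in>U. \<kappa> n t = \<kappa> n a" if "U \<noteq> {}"
        using aU[OF that] by blast
      moreover have "\<kappa> n a = 0" if "U = {}"
        using that by (simp add: a_def \<kappa>_def)
      ultimately show ?case
        unfolding P_def using insert.hyps(1) elim(1) \<kappa>
        by (intro prob_detached_insert[symmetric])
    qed
  qed
  ultimately have "(\<lambda>n. P n (insert b U)) \<longlonglongrightarrow> exp (- hit_prob (insert b U))"
    by (rule Lim_transform_eventually)
  then show ?case unfolding P_def \<kappa>_def .
qed

lemma detachment_indicator_eq_1_iff:
  "detachment_indicator n R t \<omega> = 1 \<longleftrightarrow> detached n R (nat \<lfloor>t * real n ^ 2\<rfloor>) \<omega>"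
  by (simp add: detachment_indicator_def lonely_eq_iff_detached)

lemma (in detachment_process) measurable_detachment_indicator:
  assumes "1 \<le> t"
  shows "detachment_indicator n R t \<in> borel_measurable M"
proof -
  let ?k = "nat \<lfloor>t * real n ^ 2\<rfloor>"
  have "1 * 1 \<le> t * real n ^ 2"
    using assms n_pos by (intro mult_mono) auto
  then have "1 \<le> ?k" by (simp add: le_nat_iff le_floor_iff)
  then have "{\<omega> \<in> space M. detached n R ?k \<omega>} \<in> sets (relocation_sigma ({2..?k} \<times> {1..n}))"
    by (rule detached_event) simp
  moreover have "sets (relocation_sigma ({2..?k} \<times> {1..n})) \<subseteq> events"
    by (rule relocation_sigma_subset_events) auto
  ultimately have [measurable]: "Measurable.pred M (detached n R ?k)"
    unfolding pred_def by (rule rev_subsetD)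
  show ?thesis
    unfolding detachment_indicator_def[abs_def] lonely_eq_iff_detached by measurable
qed

theorem theorem4p1:
  fixes M :: "nat \<Rightarrow> 'a measure"
    and R :: "nat \<Rightarrow> nat \<Rightarrow> nat \<Rightarrow> 'a \<Rightarrow> bool"
  assumes "\<And>n. n \<ge> 1 \<Longrightarrow> detachment_process (M n) n (R n)"
  shows "\<exists>(N :: (real \<Rightarrow> real) measure) (Y :: real \<Rightarrow> (real \<Rightarrow> real) \<Rightarrow> real).
    prob_space N \<and>
    (\<forall>t\<ge>1. Y t \<in> borel_measurable N) \<and>
    (\<forall>\<omega>\<in>space N. cadlag_on_ge1 (\<lambda>t. Y t \<omega>)) \<and>
    fdd_converges {1..} M (\<lambda>n. detachment_indicator n (R n)) N Y"
proof -
  \<comment> \<open>The explicit limit is transported along the injection \<open>encode\<close>, and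
    \<open>inv encode\<close> recovers the original point, so all laws are preserved.\<close>
  define N where "N = embed_measure shared_pairs_law encode"
  define Y where "Y = (\<lambda>t \<omega>. no_sharing t (inv encode \<omega>))"
  have Y_encode: "Y t (encode z) = no_sharing t z" for t z
    by (simp add: Y_def inv_f_f[OF inj_encode])
  have Y: "Y t \<in> borel_measurable N" for t
    unfolding N_def
    by (rule measurable_embed_measure1) (simp add: Y_encode measurable_no_sharing)
  have N: "prob_space N"
    unfolding N_def
    by (subst embed_measure_eq_distr[OF inj_encode])
      (intro prob_space.prob_space_distr prob_space_shared_pairs_law
        measurable_embed_measure2 inj_encode)
  have fdd: "measure N {\<omega> \<in> space N. \<forall>t\<in>U. Y t \<omega> = 1} = exp (- hit_prob U)" if "finite U" for U
  proof -
    have "{\<omega> \<in> space N. \<forall>t\<in>U. Y t \<omega> = 1} \<in> sets N"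
    proof (intro sets.sets_Collect_finite_All that)
      fix t
      have [measurable]: "Y t \<in> borel_measurable N" by (rule Y)
      show "{\<omega> \<in> space N. Y t \<omega> = 1} \<in> sets N" by measurable
    qed
    then have "emeasure N {\<omega> \<in> space N. \<forall>t\<in>U. Y t \<omega> = 1} =
        emeasure shared_pairs_law (encode -` {\<omega> \<in> space N. \<forall>t\<in>U. Y t \<omega> = 1} \<inter> space shared_pairs_law)"
      unfolding N_def by (rule emeasure_embed_measure[OF inj_encode])
    also have "encode -` {\<omega> \<in> space N. \<forall>t\<in>U. Y t \<omega> = 1} \<inter> space shared_pairs_law =
        {z. \<forall>t\<in>U. no_sharing t z = 1}"
      by (auto simp: N_def space_embed_measure Y_encode)
    finally show ?thesis
      using measure_no_sharing[OF that] by (simp add: measure_def)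
  qed
  have "fdd_converges {1..} M (\<lambda>n. detachment_indicator n (R n)) N Y"
  proof (rule fdd_converges_01I)
    show "prob_space (M n)" if "n \<ge> 1" for n
      using assms[OF that] by (simp add: detachment_process_def)
    show "detachment_indicator n (R n) t \<in> borel_measurable (M n)" if "n \<ge> 1" "t \<in> {1..}" for n t
      using detachment_process.measurable_detachment_indicator[OF assms[OF that(1)]] that(2) by simp
    show "detachment_indicator n (R n) t \<omega> = 0 \<or> detachment_indicator n (R n) t \<omega> = 1" for n t \<omega>
      by (simp add: detachment_indicator_def)
    show "Y t \<omega> = 0 \<or> Y t \<omega> = 1" for t \<omega>
      by (simp add: Y_def no_sharing_def)
    show "(\<lambda>n. measure (M n) {\<omega> \<in> space (M n). \<forall>t\<in>U. detachment_indicator n (R n) t \<omega> = 1})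
        \<longlonglongrightarrow> measure N {\<omega> \<in> space N. \<forall>t\<in>U. Y t \<omega> = 1}" if "finite U" "U \<subseteq> {1..}" for U
      using prob_detached_tendsto[OF assms that]
      by (simp add: fdd[OF that(1)] detachment_indicator_eq_1_iff)
  qed (use N Y in auto)
  \<comment> \<open>Every value of \<open>inv encode\<close> is a legitimate configuration, and
    every configuration has a regular path.\<close>
  moreover have "cadlag_on_ge1 (\<lambda>t. Y t \<omega>)" if "\<omega> \<in> space N" for \<omega>
    unfolding Y_def by (rule cadlag_no_sharing)
  ultimately show ?thesis using N Y by blast
qed

end
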